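(* Let $D$ be a double chain of $N=2n$ points. Then $D$ admits at least $\Omega(7.164102920^N)$ ncp partitions and at least $\Omega(6.164492582^N)$ ncpws partitions.
   Context: A non-crossing path partition (ncp partition) of a planar point set $S$ is a graph with vertex set $S$ and straight-line edges, no two of which cross, every connected component of which is a path; isolated vertices (singletons) are allowed and regarded as paths of length $0$. An ncpws partition (non-crossing path partition without singletons) is an ncp partition in which every path has at least one edge. A double chain of $N=2n$ points is a planar point set such that $n$ of the points lie on an upper convex chain $U$ and the other $n$ lie on a lower convex chain $L$, the two chains having opposite concavity; for every pair of points of $U$, the line through them leaves all points of $L$ below it; and for every pair of points of $L$, the line through them leaves all points of $U$ above it. *)

theory Defs
  imports "HOL-Analysis.Analysis"
begin

type_synonym point = "real \<times> real"

text \<open>Orientation determinant of the ordered triple (p, q, r): positive for a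
left (counterclockwise) turn, negative for a right (clockwise) turn.\<close>
definition orient :: "point \<Rightarrow> point \<Rightarrow> point \<Rightarrow> real" where
  "orient p q r = (fst q - fst p) * (snd r - snd p) - (snd q - snd p) * (fst r - fst p)"

definition strictly_below_line :: "point \<Rightarrow> point \<Rightarrow> point \<Rightarrow> bool" where
  "strictly_below_line p q r \<longleftrightarrow>
     snd r < snd p + (snd q - snd p) / (fst q - fst p) * (fst r - fst p)"

definition strictly_above_line :: "point \<Rightarrow> point \<Rightarrow> point \<Rightarrow> bool" where
  "strictly_above_line p q r \<longleftrightarrow>
     snd r > snd p + (snd q - snd p) / (fst q - fst p) * (fst r - fst p)"

definition x_sorted :: "point list \<Rightarrow> bool" where
  "x_sorted ps \<longleftrightarrow> (\<forall>i j. i < j \<and> j < length ps \<longrightarrow> fst (ps ! i) < fst (ps ! j))"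

definition cup_chain :: "point list \<Rightarrow> bool" where
  "cup_chain ps \<longleftrightarrow> x_sorted ps \<and>
     (\<forall>i j k. i < j \<and> j < k \<and> k < length ps \<longrightarrow> orient (ps ! i) (ps ! j) (ps ! k) > 0)"

definition cap_chain :: "point list \<Rightarrow> bool" where
  "cap_chain ps \<longleftrightarrow> x_sorted ps \<and>
     (\<forall>i j k. i < j \<and> j < k \<and> k < length ps \<longrightarrow> orient (ps ! i) (ps ! j) (ps ! k) < 0)"

text \<open>Double chain of 2n points: upper chain U and lower chain L, n points each,
with opposite concavity (facing each other: U bends downwards towards L, L bends
upwards towards U, as in the standard double chain whose convex hull is a
quadrilateral), every line through two points of U leaves all of L strictly below
it, and every line through two points of L leaves all of U strictly above it.\<close>
definition double_chain :: "nat \<Rightarrow> point list \<Rightarrow> point list \<Rightarrow> bool" where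
  "double_chain n U L \<longleftrightarrow>
     length U = n \<and> length L = n \<and> set U \<inter> set L = {} \<and>
     cup_chain U \<and> cap_chain L \<and>
     (\<forall>p\<in>set U. \<forall>q\<in>set U. fst p < fst q \<longrightarrow> (\<forall>r\<in>set L. strictly_below_line p q r)) \<and>
     (\<forall>p\<in>set L. \<forall>q\<in>set L. fst p < fst q \<longrightarrow> (\<forall>r\<in>set U. strictly_above_line p q r))"

definition path_edges :: "'a list \<Rightarrow> 'a set set" where
  "path_edges ps = {{ps ! i, ps ! Suc i} | i. Suc i < length ps}"

text \<open>E is a graph on S every connected component of which is a path
(singletons allowed, as paths of length 0): S is partitioned into vertex
sequences of paths, and E is exactly the union of their edges.  If
no_singletons, every path must have at least one edge.\<close>
definition path_partition :: "bool \<Rightarrow> 'a set \<Rightarrow> 'a set set \<Rightarrow> bool" where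
  "path_partition no_singletons S E \<longleftrightarrow>
     (\<exists>Ps :: 'a list set.
        (\<forall>ps\<in>Ps. ps \<noteq> [] \<and> distinct ps \<and> (no_singletons \<longrightarrow> length ps \<ge> 2)) \<and>
        (\<forall>ps\<in>Ps. \<forall>qs\<in>Ps. ps \<noteq> qs \<longrightarrow> set ps \<inter> set qs = {}) \<and>
        (\<Union>ps\<in>Ps. set ps) = S \<and>
        E = (\<Union>ps\<in>Ps. path_edges ps))"

definition non_crossing :: "point set set \<Rightarrow> bool" where
  "non_crossing E \<longleftrightarrow>
     (\<forall>e\<in>E. \<forall>f\<in>E. e \<noteq> f \<longrightarrow> (convex hull e) \<inter> (convex hull f) \<subseteq> e \<inter> f)"

definition ncp_partition :: "point set \<Rightarrow> point set set \<Rightarrow> bool" where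
  "ncp_partition S E \<longleftrightarrow> path_partition False S E \<and> non_crossing E"

definition ncpws_partition :: "point set \<Rightarrow> point set set \<Rightarrow> bool" where
  "ncpws_partition S E \<longleftrightarrow> path_partition True S E \<and> non_crossing E"

end

theory Submission
  imports Defs
begin

text \<open>On each chain only special path forests are used: every path has its leftmost vertex as an end,
  each further vertex is the lowest or the highest of the remaining ones, and every path carries at
  most one marked end vertex (in the absence of singletons, a one-vertex path must be marked).
  Given such a forest on each chain with equally many marks, joining the \<open>i\<close>-th marked vertex of the upper
  chain to the \<open>i\<close>-th one of the lower chain creates no crossing, and no cycle because every
  path is joined at most once; the two forests can be read off the result. By Cauchy-Schwarz the
  number of such pairs is at least \<open>p n\<^sup>2 / (n + 1)\<close>, where \<open>p n\<close> counts the marked forests on \<open>n\<close> vertices.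

  The generating functions \<open>P\<close> of forests and \<open>D\<close> of the remaining parts of a path satisfy
  \<open>P = 1 + w z P + 3 z D\<close> and \<open>D = z P\<^sup>2 + 2 z P D\<close>, where \<open>w\<close> is the number of kinds of singletons (\<open>1\<close> or \<open>2\<close>).
  At \<open>z = 1 / (w + 21/4)\<close> this system has no real solution, so the series of \<open>p\<close> diverges there;
  as \<open>p\<close> is supermultiplicative, its growth rate is at least \<open>w + 21/4\<close>, which exceeds both required
  constants.\<close>

subsection \<open>Counting marked forests\<close>

text \<open>A forest lives on an interval of vertices and is read from left to right. A \<open>spine\<close> is the
  non-empty rest of a path, on the interval of vertices that its previous vertex sees: the next
  vertex is the last one of the path (\<open>Tip\<close>, with forests left and right of it), or the lowest
  remaining one (\<open>Low\<close>, with a forest to its left), or the highest remaining one (\<open>High\<close>, with a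
  forest to its right).\<close>

datatype mark = Unmarked | First_Marked | Last_Marked

datatype 'f forest = Empty | Single 'f "'f forest" | Path mark "'f spine"
and 'f spine = Tip "'f forest" "'f forest" | Low "'f forest" "'f spine" | High "'f spine" "'f forest"

primrec fsize :: "'f forest \<Rightarrow> nat" and ssize :: "'f spine \<Rightarrow> nat" where
  "fsize Empty = 0"
| "fsize (Single b t) = Suc (fsize t)"
| "fsize (Path k d) = Suc (ssize d)"
| "ssize (Tip t t') = Suc (fsize t + fsize t')"
| "ssize (Low t d) = Suc (fsize t + ssize d)"
| "ssize (High d t) = Suc (ssize d + fsize t)"

section \<open>Level sets of forests and spines, and the recurrences for their sizes\<close>

lemma card_pairs_level:
  fixes f :: "'a \<Rightarrow> nat" and g :: "'b \<Rightarrow> nat"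
  assumes "\<And>i. i \<le> n \<Longrightarrow> finite {x. f x = i}" and "\<And>i. i \<le> n \<Longrightarrow> finite {y. g y = i}"
  shows "finite {(x, y). f x + g y = n}"
    and "card {(x, y). f x + g y = n} = (\<Sum>i\<le>n. card {x. f x = i} * card {y. g y = n - i})"
proof -
  have eq: "{(x, y). f x + g y = n} = (\<Union>i\<le>n. {x. f x = i} \<times> {y. g y = n - i})"
    by auto
  show "finite {(x, y). f x + g y = n}"
    unfolding eq using assms by auto
  have "card (\<Union>i\<le>n. {x. f x = i} \<times> {y. g y = n - i})
      = (\<Sum>i\<le>n. card ({x. f x = i} \<times> {y. g y = n - i}))"
    by (rule card_UN_disjoint) (use assms in auto)
  then show "card {(x, y). f x + g y = n} = (\<Sum>i\<le>n. card {x. f x = i} * card {y. g y = n - i})"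
    unfolding eq by (simp add: card_cartesian_product)
qed

lemma UNIV_mark: "(UNIV :: mark set) = {Unmarked, First_Marked, Last_Marked}"
  using mark.exhaust by auto

instance mark :: finite
  by standard (simp add: UNIV_mark)

lemma forest_level_0: "{t. fsize t = 0} = {Empty}"
proof -
  have "fsize t = 0 \<longleftrightarrow> t = Empty" for t :: "'f forest"
    by (cases t) auto
  then show ?thesis by auto
qed

lemma forest_level_Suc:
  "{t. fsize t = Suc n}
     = case_prod Single ` (UNIV \<times> {t. fsize t = n}) \<union> case_prod Path ` (UNIV \<times> {d. ssize d = n})"
  (is "?L = ?R")
proof
  show "?L \<subseteq> ?R"
  proof
    fix t :: "'a forest" assume "t \<in> ?L"
    then show "t \<in> ?R" by (cases t) (auto simp: image_iff)
  qed
qed auto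

lemma spine_level_0: "{d. ssize d = 0} = {}"
proof -
  have "ssize d \<noteq> 0" for d :: "'f spine" by (cases d) auto
  then show ?thesis by auto
qed

lemma spine_level_Suc:
  "{d. ssize d = Suc n}
     = case_prod Tip ` {(t, t'). fsize t + fsize t' = n}
       \<union> case_prod Low ` {(t, d). fsize t + ssize d = n}
       \<union> (\<lambda>(t, d). High d t) ` {(t, d). fsize t + ssize d = n}"
  (is "?L = ?R")
proof
  show "?L \<subseteq> ?R"
  proof
    fix d :: "'a spine" assume "d \<in> ?L"
    then show "d \<in> ?R" by (cases d) (auto simp: image_iff)
  qed
qed auto

lemma finite_levels:
  "finite {t :: 'f :: finite forest. fsize t = n}" "finite {d :: 'f spine. ssize d = n}"
proof (induction n rule: less_induct)
  case (less n)
  {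
    case 1
    show ?case
      using less by (cases n) (auto simp: forest_level_0 forest_level_Suc)
  next
    case 2
    show ?case
    proof (cases n)
      case (Suc m)
      have "finite {(t :: 'f forest, t' :: 'f forest). fsize t + fsize t' = m}"
        "finite {(t :: 'f forest, d :: 'f spine). fsize t + ssize d = m}"
        by (rule card_pairs_level; use less Suc in auto)+
      then show ?thesis
        unfolding Suc spine_level_Suc by blast
    qed (simp add: spine_level_0)
  }
qed

text \<open>Real-valued, ready for power series. The type argument selects the kinds of singletons;
  their number \<open>CARD('f)\<close> is the \<open>w\<close> of the generating functions.\<close>

definition forest_count :: "'f itself \<Rightarrow> nat \<Rightarrow> real" where
  "forest_count TYPE('f) n = real (card {t :: 'f forest. fsize t = n})"

definition spine_count :: "'f itself \<Rightarrow> nat \<Rightarrow> real" where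
  "spine_count TYPE('f) n = real (card {d :: 'f spine. ssize d = n})"

lemma forest_count_0: "forest_count TYPE('f) 0 = 1"
  by (simp add: forest_count_def forest_level_0)

lemma spine_count_0: "spine_count TYPE('f) 0 = 0"
  by (simp add: spine_count_def spine_level_0)

text \<open>Coefficient form of P = 1 + w z P + 3 z D: the first vertex is a singleton of one of the
  w kinds, or it starts a path bearing one of the three marks.\<close>

lemma forest_count_Suc:
  "forest_count TYPE('f :: finite) (Suc n)
     = real CARD('f) * forest_count TYPE('f) n + 3 * spine_count TYPE('f) n"
proof -
  have "card {t :: 'f forest. fsize t = Suc n}
      = card (case_prod Single ` (UNIV \<times> {t :: 'f forest. fsize t = n}))
        + card (case_prod Path ` (UNIV \<times> {d :: 'f spine. ssize d = n}))"
    unfolding forest_level_Suc by (rule card_Un_disjoint) (auto simp: finite_levels)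
  also have "card (case_prod Single ` (UNIV \<times> {t :: 'f forest. fsize t = n}))
      = CARD('f) * card {t :: 'f forest. fsize t = n}"
    by (subst card_image) (auto simp: inj_on_def card_cartesian_product)
  also have "card (case_prod Path ` (UNIV \<times> {d :: 'f spine. ssize d = n}))
      = 3 * card {d :: 'f spine. ssize d = n}"
    by (subst card_image) (auto simp: inj_on_def card_cartesian_product UNIV_mark)
  finally show ?thesis
    by (simp add: forest_count_def spine_count_def)
qed

text \<open>Coefficient form of the equation for D: the square of P comes from \<open>Tip\<close>,
  the factor 2 from the mirror images \<open>Low\<close> and \<open>High\<close>.\<close>

lemma spine_count_Suc:
  "spine_count TYPE('f :: finite) (Suc n)
     = (\<Sum>i\<le>n. forest_count TYPE('f) i * forest_count TYPE('f) (n - i))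
       + 2 * (\<Sum>i\<le>n. forest_count TYPE('f) i * spine_count TYPE('f) (n - i))"
proof -
  let ?PP = "{(t :: 'f forest, t' :: 'f forest). fsize t + fsize t' = n}"
  let ?PD = "{(t :: 'f forest, d :: 'f spine). fsize t + ssize d = n}"
  have PP: "finite ?PP"
    "card ?PP = (\<Sum>i\<le>n. card {t :: 'f forest. fsize t = i} * card {t :: 'f forest. fsize t = n - i})"
    by (rule card_pairs_level; simp add: finite_levels)+
  have PD: "finite ?PD"
    "card ?PD = (\<Sum>i\<le>n. card {t :: 'f forest. fsize t = i} * card {d :: 'f spine. ssize d = n - i})"
    by (rule card_pairs_level; simp add: finite_levels)+
  have "card {d :: 'f spine. ssize d = Suc n}
      = card (case_prod Tip ` ?PP \<union> case_prod Low ` ?PD) + card ((\<lambda>(t, d). High d t) ` ?PD)"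
    unfolding spine_level_Suc by (rule card_Un_disjoint) (use PP(1) PD(1) in auto)
  also have "card (case_prod Tip ` ?PP \<union> case_prod Low ` ?PD)
      = card (case_prod Tip ` ?PP) + card (case_prod Low ` ?PD)"
    by (rule card_Un_disjoint) (use PP(1) PD(1) in auto)
  also have "card (case_prod Tip ` ?PP) = card ?PP"
    by (rule card_image) (auto simp: inj_on_def)
  also have "card (case_prod Low ` ?PD) = card ?PD"
    by (rule card_image) (auto simp: inj_on_def)
  also have "card ((\<lambda>(t, d). High d t) ` ?PD) = card ?PD"
    by (rule card_image) (auto simp: inj_on_def)
  finally show ?thesis
    by (simp add: forest_count_def spine_count_def PP(2) PD(2))
qed

section \<open>Growth rate of the forest counts\<close>

lemma forest_count_nonneg: "forest_count TYPE('f) n \<ge> 0"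
  and spine_count_nonneg: "spine_count TYPE('f) n \<ge> 0"
  by (simp_all add: forest_count_def spine_count_def)

lemma forest_count_ge_1: "forest_count TYPE('f :: finite) n \<ge> 1"
proof (induction n)
  case (Suc n)
  have "1 * forest_count TYPE('f) n \<le> real CARD('f) * forest_count TYPE('f) n"
    by (rule mult_right_mono) (use forest_count_nonneg in \<open>auto simp: Suc_le_eq\<close>)
  with Suc spine_count_nonneg[of n, where ?'f = 'f] show ?case
    unfolding forest_count_Suc by linarith
qed (simp add: forest_count_0)

text \<open>Simultaneous induction along the recurrences: inside each convolution the induction
  hypothesis enlarges the second factor, and the additional terms of the longer sum are
  nonnegative.\<close>

lemma counts_supermult:
  "forest_count TYPE('f :: finite) m * forest_count TYPE('f) k \<le> forest_count TYPE('f) (m + k)"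
  "spine_count TYPE('f) m * forest_count TYPE('f) k \<le> spine_count TYPE('f) (m + k)"
proof (induction m rule: less_induct)
  case (less m)
  let ?p = "forest_count TYPE('f)" and ?d = "spine_count TYPE('f)"
  note nonneg = forest_count_nonneg[where ?'f = 'f] spine_count_nonneg[where ?'f = 'f]
  {
    case 1
    show ?case
    proof (cases m)
      case (Suc j)
      have "real CARD('f) * (?p j * ?p k) \<le> real CARD('f) * ?p (j + k)"
        using less(1)[of j] Suc by (intro mult_left_mono) auto
      moreover have "?d j * ?p k \<le> ?d (j + k)"
        using less(2)[of j] Suc by simp
      ultimately show ?thesis
        unfolding Suc add_Suc forest_count_Suc distrib_right mult.assoc by linarith
    qed (simp add: forest_count_0)
  next
    case 2
    show ?case
    proof (cases m)
      case (Suc j)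
      \<comment> \<open>One convolution estimate serves both sums: \<open>f\<close> is the forest
        count for \<open>Tip\<close> and the spine count for \<open>Low\<close> and
        \<open>High\<close>.\<close>
      have *: "(\<Sum>i\<le>j. ?p i * f (j - i)) * ?p k \<le> (\<Sum>i\<le>j + k. ?p i * f (j + k - i))"
        if f: "\<And>i. f i \<ge> 0" "\<And>i. i < m \<Longrightarrow> f i * ?p k \<le> f (i + k)" for f :: "nat \<Rightarrow> real"
      proof -
        have "(\<Sum>i\<le>j. ?p i * f (j - i)) * ?p k = (\<Sum>i\<le>j. ?p i * (f (j - i) * ?p k))"
          by (simp add: sum_distrib_right mult.assoc)
        also have "\<dots> \<le> (\<Sum>i\<le>j. ?p i * f (j + k - i))"
        proof (intro sum_mono mult_left_mono nonneg)
          fix i assume "i \<in> {..j}"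
          then show "f (j - i) * ?p k \<le> f (j + k - i)"
            using f(2)[of "j - i"] Suc by (simp add: algebra_simps)
        qed
        also have "\<dots> \<le> (\<Sum>i\<le>j + k. ?p i * f (j + k - i))"
          by (rule sum_mono2) (auto simp: nonneg f)
        finally show ?thesis .
      qed
      have "(\<Sum>i\<le>j. ?p i * ?p (j - i)) * ?p k \<le> (\<Sum>i\<le>j + k. ?p i * ?p (j + k - i))"
        by (rule *) (use nonneg less(1) in auto)
      moreover have "(\<Sum>i\<le>j. ?p i * ?d (j - i)) * ?p k \<le> (\<Sum>i\<le>j + k. ?p i * ?d (j + k - i))"
        by (rule *) (use nonneg less(2) in auto)
      ultimately show ?thesis
        unfolding Suc add_Suc spine_count_Suc by (simp add: algebra_simps)
    qed (simp add: spine_count_0 nonneg)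
  }
qed

text \<open>Were the series convergent, its sum P and the corresponding D would be real solutions of
  the functional equations at 1 / \<beta>. With g in place of 21/4 they yield (2g + 3) P^2 - (g + 2)
  \<beta> P + \<beta>^2 = 0, of discriminant \<beta>^2 (g^2 - 4g - 8), which is negative for 0 \<le>
  g < 2 + 2 sqrt 3 = 5.46...; 21/4 is a convenient rational in this range.\<close>

lemma counts_not_summable:
  assumes \<beta>: "\<beta> = real CARD('f :: finite) + 21/4"
  shows "\<not> summable (\<lambda>n. forest_count TYPE('f) n / \<beta> ^ n)"
proof
  let ?p = "\<lambda>n. forest_count TYPE('f) n / \<beta> ^ n" and ?d = "\<lambda>n. spine_count TYPE('f) n / \<beta> ^ n"
  define P where "P = suminf ?p"
  define D where "D = suminf ?d"
  define w where "w = real CARD('f)"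
  have pos: "\<beta> > 0" "w \<ge> 0" unfolding \<beta> w_def by simp_all
  have nonneg: "?p n \<ge> 0" "?d n \<ge> 0" for n
    using pos by (simp_all add: forest_count_nonneg spine_count_nonneg)
  assume sp: "summable ?p"
  have p_Suc: "\<beta> * ?p (Suc n) = w * ?p n + 3 * ?d n" for n
    using pos by (simp add: forest_count_Suc w_def field_simps)
  \<comment> \<open>Each spine term is dominated by the following forest term, so convergence passes
    from the forest series to the spine series.\<close>
  have "3 * ?d n \<le> \<beta> * ?p (Suc n)" for n
    using mult_nonneg_nonneg[OF pos(2) nonneg(1)[of n]] p_Suc[of n] by linarith
  moreover have sp': "summable (\<lambda>n. \<beta> * ?p (Suc n))"
    using sp by (intro summable_mult) (simp only: summable_Suc_iff[of ?p])
  moreover have "norm (3 * ?d n) = 3 * ?d n" for n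
    unfolding real_norm_def by (rule abs_of_nonneg) (use nonneg(2)[of n] in linarith)
  ultimately have "summable (\<lambda>n. 3 * ?d n)"
    by (intro summable_comparison_test'[OF sp', of 0]) (simp only:)
  from summable_mult[OF this, of "1/3"] have sd: "summable ?d"
    by simp
  have "(\<Sum>n. \<beta> * ?p (Suc n)) = \<beta> * (\<Sum>n. ?p (Suc n))"
    by (rule suminf_mult) (use sp in \<open>simp only: summable_Suc_iff[of ?p]\<close>)
  also have "(\<Sum>n. ?p (Suc n)) = P - 1"
    using suminf_split_head[OF sp] by (simp add: P_def forest_count_0)
  also have "(\<Sum>n. \<beta> * ?p (Suc n)) = (\<Sum>n. w * ?p n + 3 * ?d n)"
    by (simp only: p_Suc)
  also have "\<dots> = w * P + 3 * D"
    unfolding P_def D_def using sp sd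
    by (subst suminf_add [symmetric]) (auto simp only: suminf_mult summable_mult)
  finally have P_eq: "w * P + 3 * D = \<beta> * (P - 1)" .

  \<comment> \<open>The power of \<beta> splits over the two factors, so the spine recurrence
    becomes a Cauchy product of the scaled sequences.\<close>
  have cauchy: "(\<Sum>i\<le>n. ?p i * (f (n - i) / \<beta> ^ (n - i)))
      = (\<Sum>i\<le>n. forest_count TYPE('f) i * f (n - i)) / \<beta> ^ n" for f :: "nat \<Rightarrow> real" and n
    unfolding sum_divide_distrib by (rule sum.cong) (auto simp: power_add [symmetric])
  have d_Suc: "\<beta> * ?d (Suc n) = (\<Sum>i\<le>n. ?p i * ?p (n - i)) + 2 * (\<Sum>i\<le>n. ?p i * ?d (n - i))" for n
    unfolding cauchy using pos by (simp add: spine_count_Suc field_simps)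
  have norms: "summable (\<lambda>n. norm (?p n))" "summable (\<lambda>n. norm (?d n))"
    using sp sd by (simp_all only: real_norm_def abs_of_nonneg nonneg)
  have "(\<lambda>n. \<Sum>i\<le>n. ?p i * ?p (n - i)) sums (P * P)"
    "(\<lambda>n. \<Sum>i\<le>n. ?p i * ?d (n - i)) sums (P * D)"
    unfolding P_def D_def by (intro Cauchy_product_sums norms)+
  then have "(\<lambda>n. \<beta> * ?d (Suc n)) sums (P * P + 2 * (P * D))"
    unfolding d_Suc by (intro sums_add sums_mult)
  moreover have "(\<lambda>n. \<beta> * ?d (Suc n)) sums (\<beta> * D)"
    using sums_Suc_iff[of ?d D] summable_sums[OF sd] unfolding D_def
    by (intro sums_mult) (simp add: spine_count_0)
  ultimately have D_eq: "\<beta> * D = P * P + 2 * (P * D)"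
    by (rule sums_unique2[symmetric])
  \<comment> \<open>Eliminating \<open>D\<close> leaves a quadratic equation for \<open>P\<close> of negative discriminant.\<close>
  have "(\<beta> - 2 * P) * (\<beta> * (P - 1) - w * P) = 3 * P * P"
    using P_eq D_eq by algebra
  moreover have "\<beta> * (P - 1) - w * P = 21/4 * P - \<beta>"
    unfolding \<beta> w_def by (simp add: field_simps)
  ultimately have "(\<beta> - 2 * P) * (21/4 * P - \<beta>) = 3 * P * P"
    by simp
  then have "27/2 * (P * P) - 29/4 * (\<beta> * P) + \<beta> * \<beta> = 0"
    by algebra
  \<comment> \<open>Completing the square: the remainder has the factor 1 - 841/864 > 0, so with
    \<beta> > 0 the left side cannot vanish.\<close>
  moreover have "27/2 * (P - 29/108 * \<beta>)\<^sup>2 + (1 - 841/864) * \<beta>\<^sup>2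
      = 27/2 * (P * P) - 29/4 * (\<beta> * P) + \<beta> * \<beta>"
    by algebra
  ultimately have zero: "27/2 * (P - 29/108 * \<beta>)\<^sup>2 + (1 - 841/864) * \<beta>\<^sup>2 = 0"
    by (rule trans[rotated])
  have "27/2 * (P - 29/108 * \<beta>)\<^sup>2 \<ge> 0" "(1 - 841/864) * \<beta>\<^sup>2 > 0"
    using pos by simp_all
  from add_nonneg_pos[OF this] have "0 < (0 :: real)"
    by (simp only: zero)
  then show False by simp
qed

text \<open>If the count at m stayed below \<theta>^m for every positive m, a geometric series would
  dominate the divergent series above. So some m reaches \<theta>^m, and supermultiplicativity
  spreads this to all multiples of m.\<close>

lemma forest_count_growth:
  assumes \<theta>: "\<theta> < real CARD('f :: finite) + 21/4" "\<theta> \<ge> 1"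
  shows "\<exists>c>0. \<forall>n. forest_count TYPE('f) n \<ge> c * \<theta> ^ n"
proof -
  let ?p = "forest_count TYPE('f)"
  define \<beta> where "\<beta> = real CARD('f) + 21/4"
  have \<beta>: "\<theta> < \<beta>" "\<beta> > 0" using \<theta> by (simp_all add: \<beta>_def)
  have "\<exists>m>0. ?p m \<ge> \<theta> ^ m"
  proof (rule ccontr)
    assume "\<not> ?thesis"
    then have less: "?p m < \<theta> ^ m" if "m > 0" for m
      using that by (meson not_le)
    have "norm (?p m / \<beta> ^ m) \<le> (\<theta> / \<beta>) ^ m" if "m \<ge> 1" for m
      using less[of m] that \<beta> forest_count_nonneg[of m, where ?'f = 'f]
      by (simp add: power_divide divide_right_mono)
    moreover have "summable (\<lambda>m. (\<theta> / \<beta>) ^ m)"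
      using \<beta> \<theta> by (intro summable_geometric) simp
    ultimately have "summable (\<lambda>m. ?p m / \<beta> ^ m)"
      by (metis (no_types, lifting) summable_comparison_test')
    then show False
      using counts_not_summable[of \<beta>, where ?'f = 'f] \<beta>_def by simp
  qed
  then obtain m where m: "m > 0" "?p m \<ge> \<theta> ^ m" by blast
  have powers: "?p (q * m + r) \<ge> \<theta> ^ (q * m)" for q r
  proof (induction q)
    case (Suc q)
    have "\<theta> ^ (Suc q * m) = \<theta> ^ m * \<theta> ^ (q * m)"
      by (simp add: power_add)
    also have "\<dots> \<le> ?p m * ?p (q * m + r)"
      using Suc m \<theta> by (intro mult_mono) (auto simp: forest_count_nonneg)
    also have "\<dots> \<le> ?p (m + (q * m + r))"
      by (rule counts_supermult)
    finally show ?case by (simp add: add.assoc)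
  qed (simp add: forest_count_ge_1)
  \<comment> \<open>The residue \<open>n mod m\<close> is below m and \<theta> \<ge> 1, so
    discarding it loses at most the factor \<theta>^m.\<close>
  have "inverse (\<theta> ^ m) * \<theta> ^ n \<le> ?p n" for n
  proof -
    have "\<theta> ^ n = \<theta> ^ (n div m * m) * \<theta> ^ (n mod m)"
      by (simp flip: power_add)
    also have "\<dots> \<le> \<theta> ^ (n div m * m) * \<theta> ^ m"
      using \<theta> m by (intro mult_left_mono power_increasing) (auto intro: less_imp_le)
    finally have "inverse (\<theta> ^ m) * \<theta> ^ n \<le> \<theta> ^ (n div m * m)"
      using \<theta> by (simp add: field_simps)
    also have "\<dots> \<le> ?p n"
      using powers[of "n div m" "n mod m"] by simp
    finally show ?thesis .
  qed
  moreover have "inverse (\<theta> ^ m) > 0" using \<theta> by simp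
  ultimately show ?thesis by blast
qed

subsection \<open>Path families\<close>

lemma path_edges_Nil [simp]: "path_edges [] = {}"
  and path_edges_single [simp]: "path_edges [x] = {}"
  by (auto simp: path_edges_def)

lemma path_edges_Cons: "path_edges (x # y # ys) = insert {x, y} (path_edges (y # ys))"
proof -
  have "{{(x # y # ys) ! i, (x # y # ys) ! Suc i} | i. Suc i < length (x # y # ys)}
      = (\<lambda>i. {(x # y # ys) ! i, (x # y # ys) ! Suc i}) ` {..<Suc (length ys)}"
    by auto
  also have "\<dots> = insert {x, y} ((\<lambda>i. {(y # ys) ! i, (y # ys) ! Suc i}) ` {..<length ys})"
    by (simp add: lessThan_Suc_eq_insert_0 image_image)
  also have "\<dots> = insert {x, y} {{(y # ys) ! i, (y # ys) ! Suc i} | i. Suc i < length (y # ys)}"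
    by auto
  finally show ?thesis unfolding path_edges_def .
qed

lemma path_edges_append:
  "xs \<noteq> [] \<Longrightarrow> ys \<noteq> [] \<Longrightarrow>
   path_edges (xs @ ys) = insert {last xs, hd ys} (path_edges xs \<union> path_edges ys)"
proof (induction xs rule: induct_list012)
  case (2 x)
  then show ?case by (cases ys) (auto simp: path_edges_Cons)
next
  case (3 x y zs)
  then show ?case by (simp add: path_edges_Cons insert_commute)
qed simp

lemma path_edges_rev: "path_edges (rev xs) = path_edges xs"
proof (induction xs rule: induct_list012)
  case (3 x y zs)
  have "path_edges (rev (x # y # zs)) = path_edges (rev (y # zs) @ [x])"
    by simp
  also have "\<dots> = insert {last (rev (y # zs)), x} (path_edges (rev (y # zs)))"
    by (subst path_edges_append) auto
  finally show ?case
    using 3 by (simp add: path_edges_Cons insert_commute)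
qed simp_all

lemma path_edges_map: "path_edges (map f xs) = image f ` path_edges xs"
  by (induction xs rule: induct_list012) (simp_all add: path_edges_Cons)

lemma path_edges_subset: "e \<in> path_edges xs \<Longrightarrow> e \<subseteq> set xs"
  by (auto simp: path_edges_def)

definition family_edges :: "'a list set \<Rightarrow> 'a set set" where
  "family_edges A = (\<Union>xs\<in>A. path_edges xs)"

text \<open>The witness asked for by \<open>path_partition\<close>, without its length condition, so
  that families with singletons can be assembled before gluing.\<close>

definition path_family :: "'a set \<Rightarrow> 'a list set \<Rightarrow> bool" where
  "path_family S A \<longleftrightarrow>
     (\<forall>xs\<in>A. xs \<noteq> [] \<and> distinct xs) \<and>
     (\<forall>xs\<in>A. \<forall>ys\<in>A. xs \<noteq> ys \<longrightarrow> set xs \<inter> set ys = {}) \<and>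
     (\<Union>xs\<in>A. set xs) = S"

lemma path_familyD:
  assumes "path_family S A"
  shows "xs \<in> A \<Longrightarrow> xs \<noteq> []" "xs \<in> A \<Longrightarrow> distinct xs" "xs \<in> A \<Longrightarrow> set xs \<subseteq> S"
    "xs \<in> A \<Longrightarrow> ys \<in> A \<Longrightarrow> xs \<noteq> ys \<Longrightarrow> set xs \<inter> set ys = {}" "\<Union> (set ` A) = S"
  using assms unfolding path_family_def by blast+

lemma path_family_Un:
  assumes A: "path_family S A" and B: "path_family T B" and "S \<inter> T = {}"
  shows "path_family (S \<union> T) (A \<union> B)"
proof -
  have "set xs \<inter> set ys = {}" if "xs \<in> A" "ys \<in> B" for xs ys
    using path_familyD(3)[OF A that(1)] path_familyD(3)[OF B that(2)] assms(3) by blast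
  then have "set xs \<inter> set ys = {}" if "xs \<in> A \<union> B" "ys \<in> A \<union> B" "xs \<noteq> ys" for xs ys
    using that path_familyD(4)[OF A, of xs ys] path_familyD(4)[OF B, of xs ys]
    by (metis Un_iff inf_commute)
  moreover have "xs \<noteq> [] \<and> distinct xs" if "xs \<in> A \<union> B" for xs
    using that path_familyD(1,2)[OF A, of xs] path_familyD(1,2)[OF B, of xs] by blast
  moreover have "\<Union> (set ` (A \<union> B)) = S \<union> T"
    by (simp only: path_familyD(5)[OF A] path_familyD(5)[OF B] image_Un Union_Un_distrib)
  ultimately show ?thesis
    unfolding path_family_def by blast
qed

lemma path_family_single: "xs \<noteq> [] \<Longrightarrow> distinct xs \<Longrightarrow> path_family (set xs) {xs}"
  by (simp add: path_family_def)

lemma path_family_map: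
  assumes A: "path_family S A" and f: "inj_on f S"
  shows "path_family (f ` S) (map f ` A)"
  unfolding path_family_def
proof (intro conjI ballI impI)
  fix zs assume "zs \<in> map f ` A"
  then obtain xs where xs: "xs \<in> A" "zs = map f xs" by blast
  then show "zs \<noteq> []" "distinct zs"
    using path_familyD(1-3)[OF A xs(1)] f by (auto simp: distinct_map intro: inj_on_subset)
next
  fix us vs assume *: "us \<in> map f ` A" "vs \<in> map f ` A" "us \<noteq> vs"
  then obtain xs ys where xs: "xs \<in> A" "us = map f xs" and ys: "ys \<in> A" "vs = map f ys"
    by blast
  have "f ` set xs \<inter> f ` set ys = f ` (set xs \<inter> set ys)"
    by (rule inj_on_image_Int[OF f, symmetric]) (rule path_familyD(3)[OF A], fact)+
  also have "set xs \<inter> set ys = {}"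
    by (rule path_familyD(4)[OF A xs(1) ys(1)]) (use *(3) xs(2) ys(2) in auto)
  finally show "set us \<inter> set vs = {}"
    using xs ys by simp
next
  show "\<Union> (set ` map f ` A) = f ` S"
    unfolding path_familyD(5)[OF A, symmetric] by auto
qed

lemma family_edges_map: "family_edges (map f ` A) = image f ` family_edges A"
  by (auto simp: family_edges_def path_edges_map)

text \<open>Distinct paths of a family are disjoint, so a path is identified by its last vertex; a
  bijection between marked vertices can thus act on paths.\<close>

lemma path_family_inj_last:
  assumes "path_family S A" "B \<subseteq> A"
  shows "inj_on last B"
proof (rule inj_onI)
  fix xs ys assume *: "xs \<in> B" "ys \<in> B" "last xs = last ys"
  then have mem: "xs \<in> A" "ys \<in> A"
    using assms(2) by blast+
  have "last xs \<in> set xs" "last xs \<in> set ys"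
    using path_familyD(1)[OF assms(1)] mem *(3) by (metis last_in_set)+
  then show "xs = ys"
    using path_familyD(4)[OF assms(1) mem] by blast
qed

lemma UN_Diff_Un: "B \<subseteq> A \<Longrightarrow> \<Union> (f ` A) = \<Union> (f ` (A - B)) \<union> \<Union> (f ` B)"
  by blast

text \<open>No cycle arises because every path is glued at most once.\<close>

lemma path_partition_glue:
  assumes A: "path_family S A" and B: "path_family T B" and disj: "S \<inter> T = {}"
    and A': "A' \<subseteq> A" and B': "B' \<subseteq> B"
    and f: "bij_betw f (last ` A') (last ` B')"
    and ns: "ns \<Longrightarrow> \<forall>xs \<in> (A - A') \<union> (B - B'). length xs \<ge> 2"
  shows "path_partition ns (S \<union> T)
    (family_edges A \<union> family_edges B \<union> {{v, f v} | v. v \<in> last ` A'})"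
proof -
  have injA: "inj_on last A'" and injB: "inj_on last B'"
    by (rule path_family_inj_last[OF A A'], rule path_family_inj_last[OF B B'])
  \<comment> \<open>The bijection \<open>f\<close> between last vertices, carried over to the paths
    ending in them.\<close>
  define g where "g = (\<lambda>xs. the_inv_into B' last (f (last xs)))"
  have g: "bij_betw g A' B'"
  proof -
    have "bij_betw last A' (last ` A')" "bij_betw (the_inv_into B' last) (last ` B') B'"
      using injA injB by (simp_all add: inj_on_imp_bij_betw bij_betw_the_inv_into)
    from bij_betw_trans[OF bij_betw_trans[OF this(1) f] this(2)] show ?thesis
      by (simp add: g_def o_def)
  qed
  have last_g: "last (g xs) = f (last xs)" if "xs \<in> A'" for xs
    unfolding g_def by (rule f_the_inv_into_f[OF injB]) (use f that in \<open>auto simp: bij_betw_def\<close>)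
  have gB: "g xs \<in> B'" if "xs \<in> A'" for xs
    using g that by (auto simp: bij_betw_def)
  have g_inj: "g xs \<noteq> g ys" if "xs \<in> A'" "ys \<in> A'" "xs \<noteq> ys" for xs ys
    using g that by (auto simp: bij_betw_def inj_on_def)
  have B'_eq: "B' = g ` A'" using g by (simp add: bij_betw_def)
  \<comment> \<open>The second path is reversed so that the two last vertices become neighbours at
    the joint.\<close>
  define h where "h = (\<lambda>xs. xs @ rev (g xs))"
  define Ps where "Ps = (A - A') \<union> (B - B') \<union> h ` A'"
  have set_h: "set (h xs) = set xs \<union> set (g xs)" for xs by (simp add: h_def)
  note neA = path_familyD(1-3)[OF A] and neB = path_familyD(1-3)[OF B]
    and dA = path_familyD(4)[OF A] and dB = path_familyD(4)[OF B]
  have dAB: "set xs \<inter> set ys = {}" if "xs \<in> A" "ys \<in> B" for xs ys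
    using neA(3)[OF that(1)] neB(3)[OF that(2)] disj by blast
  have hA: "xs \<in> A" "g xs \<in> B" "g xs \<in> B'" if "xs \<in> A'" for xs
    using that A' B' gB by auto
  have edges_h: "path_edges (h xs) = insert {last xs, f (last xs)} (path_edges xs \<union> path_edges (g xs))"
    if "xs \<in> A'" for xs
    using that neA(1) neB(1) hA
    by (simp add: h_def path_edges_append path_edges_rev hd_rev last_g)
  show ?thesis
    unfolding path_partition_def
  proof (intro exI[of _ Ps] conjI ballI impI)
    fix xs assume xs: "xs \<in> Ps"
    then consider "xs \<in> A - A'" | "xs \<in> B - B'" | ys where "xs = h ys" "ys \<in> A'"
      by (auto simp: Ps_def)
    note cases = this
    show "xs \<noteq> []"
      by (cases rule: cases) (use neA(1) neB(1) hA in \<open>simp_all add: h_def\<close>)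
    show "distinct xs"
    proof (cases rule: cases)
      case (3 ys)
      then show ?thesis using neA(2) neB(2) hA dAB[of ys "g ys"] by (simp add: h_def)
    qed (use neA(2) neB(2) in simp_all)
    \<comment> \<open>A glued path takes at least one vertex from each side; any other path is long
      enough by hypothesis.\<close>
    show "length xs \<ge> 2" if ns
    proof (cases rule: cases)
      case 1
      then show ?thesis using bspec[OF ns[OF that], of xs] by simp
    next
      case 2
      then show ?thesis using bspec[OF ns[OF that], of xs] by simp
    next
      case (3 ys)
      then have "length ys \<ge> 1" "length (g ys) \<ge> 1"
        using neA(1) neB(1) hA by (simp_all add: Suc_le_eq)
      then show ?thesis using 3 by (simp add: h_def)
    qed
  next
    fix xs ys assume *: "xs \<in> Ps" "ys \<in> Ps" "xs \<noteq> ys"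
    have hh: "set (h as) \<inter> set (h bs) = {}" if as_bs: "as \<in> A'" "bs \<in> A'" "as \<noteq> bs" for as bs
    proof -
      have "set as \<inter> set bs = {}" "set (g as) \<inter> set (g bs) = {}"
        using dA dB hA g_inj as_bs by simp_all
      moreover have "set as \<inter> set (g bs) = {}" "set bs \<inter> set (g as) = {}"
        using dAB hA as_bs by simp_all
      ultimately show ?thesis unfolding set_h by blast
    qed
    have hA': "set (h as) \<inter> set bs = {}" if as_bs: "as \<in> A'" "bs \<in> A" "bs \<notin> A'" for as bs
    proof -
      have "as \<noteq> bs" using as_bs by blast
      then have "set as \<inter> set bs = {}" "set bs \<inter> set (g as) = {}"
        using dA dAB hA as_bs by simp_all
      then show ?thesis unfolding set_h by blast
    qed
    have hB': "set (h as) \<inter> set bs = {}" if as_bs: "as \<in> A'" "bs \<in> B" "bs \<notin> B'" for as bs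
    proof -
      have "g as \<noteq> bs" using as_bs hA(3) by blast
      then have "set as \<inter> set bs = {}" "set (g as) \<inter> set bs = {}"
        using dAB dB hA as_bs by simp_all
      then show ?thesis unfolding set_h by blast
    qed
    from *(1) consider (A) "xs \<in> A" "xs \<notin> A'" | (B) "xs \<in> B" "xs \<notin> B'" | (h) as where "xs = h as" "as \<in> A'"
      unfolding Ps_def by blast
    note xs_cases = this
    from *(2) consider (A) "ys \<in> A" "ys \<notin> A'" | (B) "ys \<in> B" "ys \<notin> B'" | (h) as where "ys = h as" "as \<in> A'"
      unfolding Ps_def by blast
    then show "set xs \<inter> set ys = {}"
    proof cases
      case ys: A
      show ?thesis
        by (cases rule: xs_cases)
          (use ys * dA[of xs ys] dAB[of ys xs] hA'[of _ ys] in blast)+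
    next
      case ys: B
      show ?thesis
        by (cases rule: xs_cases)
          (use ys * dB[of xs ys] dAB[of xs ys] hB'[of _ ys] in blast)+
    next
      case ys: (h as)
      show ?thesis
        by (cases rule: xs_cases)
          (use ys * hh[of _ as] hA'[of as xs] hB'[of as xs] in blast)+
    qed
  next
    show "\<Union> (set ` Ps) = S \<union> T"
    proof -
      have "\<Union> (set ` Ps) = \<Union> (set ` (A - A')) \<union> \<Union> (set ` (B - B')) \<union> (\<Union> (set ` A') \<union> \<Union> (set ` g ` A'))"
        unfolding Ps_def by (auto simp: set_h)
      also have "\<dots> = \<Union> (set ` A) \<union> \<Union> (set ` B)"
        unfolding B'_eq [symmetric] UN_Diff_Un[OF A'] UN_Diff_Un[OF B'] by (simp only: Un_ac)
      finally show ?thesis by (simp only: path_familyD(5)[OF A] path_familyD(5)[OF B])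
    qed
  next
    have "\<Union> (path_edges ` Ps) = \<Union> (path_edges ` (A - A')) \<union> \<Union> (path_edges ` (B - B'))
        \<union> (\<Union>xs\<in>A'. path_edges (h xs))"
      unfolding Ps_def by auto
    also have "(\<Union>xs\<in>A'. path_edges (h xs)) = \<Union> (path_edges ` A') \<union> \<Union> (path_edges ` g ` A')
        \<union> {{v, f v} | v. v \<in> last ` A'}"
    proof -
      have "(\<Union>xs\<in>A'. path_edges (h xs))
          = (\<Union>xs\<in>A'. insert {last xs, f (last xs)} (path_edges xs \<union> path_edges (g xs)))"
        by (rule SUP_cong) (simp_all only: edges_h)
      then show ?thesis by auto
    qed
    also have "\<Union> (path_edges ` (A - A')) \<union> \<Union> (path_edges ` (B - B')) \<union> \<dots>
        = \<Union> (path_edges ` A) \<union> \<Union> (path_edges ` B) \<union> {{v, f v} | v. v \<in> last ` A'}"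
      unfolding B'_eq [symmetric] UN_Diff_Un[OF A'] UN_Diff_Un[OF B'] by (simp only: Un_ac)
    finally show "family_edges A \<union> family_edges B \<union> {{v, f v} | v. v \<in> last ` A'} = \<Union> (path_edges ` Ps)"
      by (simp add: family_edges_def)
  qed
qed

subsection \<open>Decoding forests\<close>

text \<open>The head of \<open>vertices a d\<close>: the vertex at which the edge from the preceding
  path vertex enters the spine.\<close>

primrec root :: "nat \<Rightarrow> 'f spine \<Rightarrow> nat" where
  "root a (Tip t t') = a + fsize t"
| "root a (Low t d) = a + fsize t"
| "root a (High d t) = a + ssize d"

text \<open>Listed in the order of the path, which need not be the order of the indices; the forests
  at its sides are left out.\<close>

primrec vertices :: "nat \<Rightarrow> 'f spine \<Rightarrow> nat list" where
  "vertices a (Tip t t') = [a + fsize t]"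
| "vertices a (Low t d) = (a + fsize t) # vertices (Suc (a + fsize t)) d"
| "vertices a (High d t) = (a + ssize d) # vertices a d"

text \<open>Gluing joins paths at their last vertices, so a path marked at its first vertex is
  reversed; its edges stay the same.\<close>

fun mark_last :: "mark \<Rightarrow> 'a list \<Rightarrow> 'a list" where
  "mark_last First_Marked xs = rev xs"
| "mark_last k xs = xs"

text \<open>\<open>spaths\<close> collects only the paths of the side forests; the path running
  through the spine is added once, at \<open>Path\<close>.\<close>

primrec fpaths :: "nat \<Rightarrow> 'f forest \<Rightarrow> nat list set"
  and spaths :: "nat \<Rightarrow> 'f spine \<Rightarrow> nat list set" where
  "fpaths a Empty = {}"
| "fpaths a (Single b t) = {[a]} \<union> fpaths (Suc a) t"
| "fpaths a (Path k d) = {mark_last k (a # vertices (Suc a) d)} \<union> spaths (Suc a) d"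
| "spaths a (Tip t t') = fpaths a t \<union> fpaths (Suc (a + fsize t)) t'"
| "spaths a (Low t d) = fpaths a t \<union> spaths (Suc (a + fsize t)) d"
| "spaths a (High d t) = spaths a d \<union> fpaths (Suc (a + ssize d)) t"

text \<open>The members of \<open>fpaths\<close> that carry a mark; \<open>h\<close> tells which
  kinds of singletons are marked.\<close>

primrec fmarked :: "('f \<Rightarrow> bool) \<Rightarrow> nat \<Rightarrow> 'f forest \<Rightarrow> nat list set"
  and smarked :: "('f \<Rightarrow> bool) \<Rightarrow> nat \<Rightarrow> 'f spine \<Rightarrow> nat list set" where
  "fmarked h a Empty = {}"
| "fmarked h a (Single b t) = (if h b then {[a]} else {}) \<union> fmarked h (Suc a) t"
| "fmarked h a (Path k d) =
     (if k = Unmarked then {} else {mark_last k (a # vertices (Suc a) d)}) \<union> smarked h (Suc a) d"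
| "smarked h a (Tip t t') = fmarked h a t \<union> fmarked h (Suc (a + fsize t)) t'"
| "smarked h a (Low t d) = fmarked h a t \<union> smarked h (Suc (a + fsize t)) d"
| "smarked h a (High d t) = smarked h a d \<union> fmarked h (Suc (a + ssize d)) t"

text \<open>In \<open>sedges u a d\<close> the spine \<open>d\<close> on the vertices from \<open>a\<close> on continues a path that has reached \<open>u\<close>.\<close>

primrec fedges :: "nat \<Rightarrow> 'f forest \<Rightarrow> nat set set"
  and sedges :: "nat \<Rightarrow> nat \<Rightarrow> 'f spine \<Rightarrow> nat set set" where
  "fedges a Empty = {}"
| "fedges a (Single b t) = fedges (Suc a) t"
| "fedges a (Path k d) = sedges a (Suc a) d"
| "sedges u a (Tip t t') =
     insert {u, a + fsize t} (fedges a t \<union> fedges (Suc (a + fsize t)) t')"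
| "sedges u a (Low t d) =
     insert {u, a + fsize t} (fedges a t \<union> sedges (a + fsize t) (Suc (a + fsize t)) d)"
| "sedges u a (High d t) =
     insert {u, a + ssize d} (sedges (a + ssize d) a d \<union> fedges (Suc (a + ssize d)) t)"

text \<open>The flag \<open>e\<close> of \<open>smarks\<close> tells whether the last vertex of the path is marked.\<close>

primrec fmarks :: "('f \<Rightarrow> bool) \<Rightarrow> nat \<Rightarrow> 'f forest \<Rightarrow> nat set"
  and smarks :: "('f \<Rightarrow> bool) \<Rightarrow> bool \<Rightarrow> nat \<Rightarrow> 'f spine \<Rightarrow> nat set" where
  "fmarks h a Empty = {}"
| "fmarks h a (Single b t) = (if h b then {a} else {}) \<union> fmarks h (Suc a) t"
| "fmarks h a (Path k d) =
     (if k = First_Marked then {a} else {}) \<union> smarks h (k = Last_Marked) (Suc a) d"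
| "smarks h e a (Tip t t') =
     fmarks h a t \<union> ((if e then {a + fsize t} else {}) \<union> fmarks h (Suc (a + fsize t)) t')"
| "smarks h e a (Low t d) = fmarks h a t \<union> smarks h e (Suc (a + fsize t)) d"
| "smarks h e a (High d t) = smarks h e a d \<union> fmarks h (Suc (a + ssize d)) t"

lemma path_edges_mark_last: "path_edges (mark_last k xs) = path_edges xs"
  by (cases k) (simp_all add: path_edges_rev)

lemma set_mark_last: "set (mark_last k xs) = set xs"
  and distinct_mark_last: "distinct (mark_last k xs) = distinct xs"
  and length_mark_last: "length (mark_last k xs) = length xs"
  by (cases k; simp)+

lemma vertices_ne: "vertices a d \<noteq> []"
  by (cases d) auto

lemma vertices_props: "distinct (vertices a d) \<and> set (vertices a d) \<subseteq> {a..<a + ssize d}"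
proof (induction d arbitrary: a rule: spine.induct[where ?P1.0 = "\<lambda>_. True"])
  case (Low t d)
  then show ?case by (force simp: subset_iff)
next
  case (High d t)
  then show ?case by (force simp: subset_iff)
qed auto

lemma path_edges_Cons_vertices:
  "path_edges (u # vertices a d) = insert {u, root a d} (path_edges (vertices a d))"
  by (cases d) (simp_all add: path_edges_Cons)

lemma family_edges_Un: "family_edges (A \<union> B) = family_edges A \<union> family_edges B"
  and family_edges_insert: "family_edges (insert xs A) = path_edges xs \<union> family_edges A"
  and family_edges_empty: "family_edges {} = {}"
  by (auto simp: family_edges_def)

text \<open>Links two readings of a forest: the family of paths serves the gluing, the direct
  recursion for edges serves the crossing and decoding arguments.\<close>

lemma edges_of_paths:
  fixes t :: "'f forest" and d :: "'f spine"
  shows "fedges a t = family_edges (fpaths a t)"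
  "sedges u a d = path_edges (u # vertices a d) \<union> family_edges (spaths a d)"
  by (induction t and d arbitrary: a and a u)
    (auto simp: family_edges_Un family_edges_empty family_edges_insert path_edges_mark_last
      path_edges_Cons path_edges_Cons_vertices)

text \<open>The path through a spine cuts its interval into pieces, each filled by a side forest;
  adding the path at \<open>Path\<close> restores the full interval.\<close>

lemma path_family_paths:
  fixes t :: "'f forest" and d :: "'f spine"
  shows "path_family {a..<a + fsize t} (fpaths a t)"
  "path_family ({b..<b + ssize d} - set (vertices b d)) (spaths b d)"
proof (induction t and d arbitrary: a and b)
  case Empty
  then show ?case by (simp add: path_family_def)
next
  case (Single x t)
  have eq: "{a..<a + fsize (Single x t)} = set [a] \<union> {Suc a..<Suc a + fsize t}" by auto
  show ?case
    unfolding eq fpaths.simps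
    by (rule path_family_Un[OF path_family_single Single[of "Suc a"]]) simp_all
next
  case (Path k d)
  let ?xs = "mark_last k (a # vertices (Suc a) d)"
  have props: "distinct (vertices (Suc a) d)" "set (vertices (Suc a) d) \<subseteq> {Suc a..<Suc a + ssize d}"
    using vertices_props by blast+
  have eq: "{a..<a + fsize (Path k d)}
      = set ?xs \<union> ({Suc a..<Suc a + ssize d} - set (vertices (Suc a) d))"
    using props(2) by (auto simp: set_mark_last)
  have ne: "?xs \<noteq> []" by (cases k) simp_all
  have dist: "distinct ?xs" using props by (auto simp: distinct_mark_last)
  have disj: "set ?xs \<inter> ({Suc a..<Suc a + ssize d} - set (vertices (Suc a) d)) = {}"
    by (auto simp: set_mark_last)
  show ?case
    unfolding eq fpaths.simps
    by (rule path_family_Un[OF path_family_single[OF ne dist] Path[of "Suc a"] disj])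
next
  case (Tip t t')
  have eq: "{b..<b + ssize (Tip t t')} - set (vertices b (Tip t t'))
      = {b..<b + fsize t} \<union> {Suc (b + fsize t)..<Suc (b + fsize t) + fsize t'}" by auto
  show ?case
    unfolding eq spaths.simps
    by (rule path_family_Un[OF Tip(1)[of b] Tip(2)[of "Suc (b + fsize t)"]]) auto
next
  case (Low t d)
  let ?m = "b + fsize t"
  have "x \<le> ?m \<Longrightarrow> x \<notin> set (vertices (Suc ?m) d)" for x
    using vertices_props[of "Suc ?m" d] by auto
  then have eq: "{b..<b + ssize (Low t d)} - set (vertices b (Low t d))
      = {b..<?m} \<union> ({Suc ?m..<Suc ?m + ssize d} - set (vertices (Suc ?m) d))"
    by auto
  show ?case
    unfolding eq spaths.simps
    by (rule path_family_Un[OF Low(1)[of b] Low(2)[of "Suc ?m"]]) auto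
next
  case (High d t)
  let ?m = "b + ssize d"
  have "?m \<le> x \<Longrightarrow> x \<notin> set (vertices b d)" for x
    using vertices_props[of b d] by auto
  then have eq: "{b..<b + ssize (High d t)} - set (vertices b (High d t))
      = ({b..<?m} - set (vertices b d)) \<union> {Suc ?m..<Suc ?m + fsize t}"
    by auto
  show ?case
    unfolding eq spaths.simps
    by (rule path_family_Un[OF High(1)[of b] High(2)[of "Suc ?m"]]) auto
qed

lemma marked_subset_paths: "fmarked h a t \<subseteq> fpaths a t" "smarked h b d \<subseteq> spaths b d"
  by (induction t and d arbitrary: a and b) (auto split: if_splits)

lemma unmarked_length:
  assumes "\<And>b. h b"
  shows "xs \<in> fpaths a t \<Longrightarrow> xs \<notin> fmarked h a t \<Longrightarrow> length xs \<ge> 2"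
    and "xs \<in> spaths b d \<Longrightarrow> xs \<notin> smarked h b d \<Longrightarrow> length xs \<ge> 2"
proof (induction t and d arbitrary: a and b)
  case (Path k d)
  have "length (vertices (Suc a) d) \<ge> 1"
    using vertices_ne[of "Suc a" d] by (simp add: Suc_le_eq)
  then show ?case using Path by (auto simp: length_mark_last)
qed (use assms in auto)

text \<open>After \<open>mark_last\<close>, a mark sits at the last vertex of its path. The flag
  \<open>e\<close> accounts for the end of the path running through the spine, which is not a member
  of \<open>smarked\<close>.\<close>

lemma last_marked:
  "last ` fmarked h a t = fmarks h a t"
  "(if e then {last (vertices b d)} else {}) \<union> last ` smarked h b d = smarks h e b d"
proof (induction t and d arbitrary: a and e b)
  case (Path k d)
  then show ?case
    by (cases k) (auto simp: vertices_ne simp flip: Path)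
next
  case (Tip t t')
  then show ?case by (auto simp: image_Un simp flip: Tip)
next
  case (Low t d)
  then show ?case by (auto simp: image_Un vertices_ne simp flip: Low)
next
  case (High d t)
  then show ?case by (auto simp: image_Un vertices_ne simp flip: High)
qed auto

lemma fmarks_range: "fmarks h a t \<subseteq> {a..<a + fsize t}" "smarks h e b d \<subseteq> {b..<b + ssize d}"
proof (induction t and d arbitrary: a and e b)
  case (Path k d)
  have "smarks h (k = Last_Marked) (Suc a) d \<subseteq> {a..<a + fsize (Path k d)}"
    by (rule order.trans[OF Path]) auto
  then show ?case by simp
next
  case (Single x t)
  have "fmarks h (Suc a) t \<subseteq> {a..<a + fsize (Single x t)}"
    by (rule order.trans[OF Single]) auto
  then show ?case by simp
next
  case (Tip t t')
  have "fmarks h b t \<subseteq> {b..<b + ssize (Tip t t')}"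
    "fmarks h (Suc (b + fsize t)) t' \<subseteq> {b..<b + ssize (Tip t t')}"
    by (rule order.trans[OF Tip(1)] order.trans[OF Tip(2)]; auto)+
  then show ?case by simp
next
  case (Low t d)
  have "fmarks h b t \<subseteq> {b..<b + ssize (Low t d)}"
    "smarks h e (Suc (b + fsize t)) d \<subseteq> {b..<b + ssize (Low t d)}"
    by (rule order.trans[OF Low(1)] order.trans[OF Low(2)]; auto)+
  then show ?case by simp
next
  case (High d t)
  have "smarks h e b d \<subseteq> {b..<b + ssize (High d t)}"
    "fmarks h (Suc (b + ssize d)) t \<subseteq> {b..<b + ssize (High d t)}"
    by (rule order.trans[OF High(1)] order.trans[OF High(2)]; auto)+
  then show ?case by simp
qed simp

section \<open>Edge sets without interleaving\<close>

definition edges_on :: "nat set \<Rightarrow> nat set set" where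
  "edges_on V = {e. e \<subseteq> V \<and> card e = 2}"

lemma edges_on_mono: "V \<subseteq> W \<Longrightarrow> edges_on V \<subseteq> edges_on W"
  by (auto simp: edges_on_def)

text \<open>The vertex \<open>u\<close> may be on either side of the interval: the path stands to
  the left of the remaining interval after \<open>Low\<close> and to its right after
  \<open>High\<close>.\<close>

lemma fedges_range:
  fixes t :: "'f forest" and d :: "'f spine"
  shows "fedges a t \<subseteq> edges_on {a..<a + fsize t}"
  "u \<notin> {b..<b + ssize d} \<Longrightarrow> sedges u b d \<subseteq> edges_on (insert u {b..<b + ssize d})"
proof (induction t and d arbitrary: a and u b)
  case (Single x t)
  then show ?case using edges_on_mono[of "{Suc a..<Suc a + fsize t}" "{a..<a + fsize (Single x t)}"] by fastforce
next
  case (Path k d)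
  have "sedges a (Suc a) d \<subseteq> edges_on (insert a {Suc a..<Suc a + ssize d})"
    by (rule Path) simp
  also have "insert a {Suc a..<Suc a + ssize d} = {a..<a + fsize (Path k d)}" by auto
  finally show ?case by simp
next
  case (Tip t t')
  let ?V = "insert u {b..<b + ssize (Tip t t')}"
  have "fedges b t \<subseteq> edges_on ?V"
    by (rule order.trans[OF Tip(1) edges_on_mono]) auto
  moreover have "fedges (Suc (b + fsize t)) t' \<subseteq> edges_on ?V"
    by (rule order.trans[OF Tip(2) edges_on_mono]) auto
  ultimately show ?case
    using Tip(3) by (auto simp: edges_on_def card_insert_if)
next
  case (Low t d)
  let ?V = "insert u {b..<b + ssize (Low t d)}"
  have "fedges b t \<subseteq> edges_on ?V"
    by (rule order.trans[OF Low(1) edges_on_mono]) auto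
  moreover have "sedges (b + fsize t) (Suc (b + fsize t)) d \<subseteq> edges_on ?V"
    by (rule order.trans[OF Low(2) edges_on_mono]) auto
  ultimately show ?case
    using Low(3) by (auto simp: edges_on_def card_insert_if)
next
  case (High d t)
  let ?V = "insert u {b..<b + ssize (High d t)}"
  have "sedges (b + ssize d) b d \<subseteq> edges_on ?V"
    by (rule order.trans[OF High(1) edges_on_mono]) auto
  moreover have "fedges (Suc (b + ssize d)) t \<subseteq> edges_on ?V"
    by (rule order.trans[OF High(2) edges_on_mono]) auto
  ultimately show ?case
    using High(3) by (auto simp: edges_on_def card_insert_if)
qed (simp add: edges_on_def)

text \<open>Crossing in combinatorial form: two chords of a strictly convex chain without common
  ends cross exactly when their ends alternate along the chain.\<close>

definition interleaving_free :: "nat set set \<Rightarrow> bool" where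
  "interleaving_free E \<longleftrightarrow> (\<forall>i j k l. i < j \<longrightarrow> j < k \<longrightarrow> k < l \<longrightarrow> {i, k} \<in> E \<longrightarrow> {j, l} \<notin> E)"

text \<open>As \<open>u\<close> is outside the interval, the edge from \<open>u\<close> to
  \<open>m\<close> has all of \<open>X\<close> on one side and all of \<open>Y\<close> on the other.
  Since \<open>X\<close> and \<open>Y\<close> share at most the vertex \<open>m\<close>, no two
  edges alternate.\<close>

lemma interleaving_free_insert:
  assumes X: "interleaving_free X" "X \<subseteq> edges_on {a..m}"
    and Y: "interleaving_free Y" "Y \<subseteq> edges_on {m..<b}"
    and u: "u \<notin> {a..<b}" and m: "a \<le> m" "m < b"
  shows "interleaving_free (insert {u, m} (X \<union> Y))"
  unfolding interleaving_free_def
proof (intro allI impI notI)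
  fix i j k l :: nat
  assume less: "i < j" "j < k" "k < l"
    and ik: "{i, k} \<in> insert {u, m} (X \<union> Y)" and jl: "{j, l} \<in> insert {u, m} (X \<union> Y)"
  have XD: "a \<le> x \<and> y \<le> m \<and> a \<le> y \<and> x \<le> m" if "{x, y} \<in> X" for x y
    using that X(2) by (auto simp: edges_on_def)
  have YD: "m \<le> x \<and> y < b \<and> m \<le> y \<and> x < b" if "{x, y} \<in> Y" for x y
    using that Y(2) by (auto simp: edges_on_def)
  have "(i = u \<and> k = m) \<or> (i = m \<and> k = u) \<or> ({i, k} \<in> X \<and> a \<le> i \<and> k \<le> m)
      \<or> ({i, k} \<in> Y \<and> m \<le> i \<and> k < b)"
    using ik XD[of i k] YD[of i k] unfolding insert_iff Un_iff doubleton_eq_iff by blast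
  moreover have "(j = u \<and> l = m) \<or> (j = m \<and> l = u) \<or> ({j, l} \<in> X \<and> a \<le> j \<and> l \<le> m)
      \<or> ({j, l} \<in> Y \<and> m \<le> j \<and> l < b)"
    using jl XD[of j l] YD[of j l] unfolding insert_iff Un_iff doubleton_eq_iff by blast
  moreover have "\<not> ({i, k} \<in> X \<and> {j, l} \<in> X)" "\<not> ({i, k} \<in> Y \<and> {j, l} \<in> Y)"
    using X(1) Y(1) less unfolding interleaving_free_def by blast+
  moreover have "u < a \<or> b \<le> u" using u by auto
  ultimately show False
    using less m by (elim disjE conjE) (linarith | blast)+
qed

lemma interleaving_free_edges:
  fixes t :: "'f forest" and d :: "'f spine"
  shows "interleaving_free (fedges a t)"
  "u \<notin> {b..<b + ssize d} \<Longrightarrow> interleaving_free (sedges u b d)"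
proof (induction t and d arbitrary: a and u b)
  case (Tip t t')
  show ?case
    unfolding sedges.simps
  proof (rule interleaving_free_insert[OF Tip(1) _ Tip(2) _ Tip(3)])
    show "fedges b t \<subseteq> edges_on {b..b + fsize t}"
      by (rule order.trans[OF fedges_range(1) edges_on_mono]) auto
    show "fedges (Suc (b + fsize t)) t' \<subseteq> edges_on {b + fsize t..<b + ssize (Tip t t')}"
      by (rule order.trans[OF fedges_range(1) edges_on_mono]) auto
  qed auto
next
  case (Low t d)
  show ?case
    unfolding sedges.simps
  proof (rule interleaving_free_insert[OF Low(1) _ Low(2) _ Low(3)])
    show "fedges b t \<subseteq> edges_on {b..b + fsize t}"
      by (rule order.trans[OF fedges_range(1) edges_on_mono]) auto
    show "sedges (b + fsize t) (Suc (b + fsize t)) d \<subseteq> edges_on {b + fsize t..<b + ssize (Low t d)}"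
      by (rule order.trans[OF fedges_range(2) edges_on_mono]) auto
  qed auto
next
  case (High d t)
  show ?case
    unfolding sedges.simps
  proof (rule interleaving_free_insert[OF High(1) _ High(2) _ High(3)])
    show "sedges (b + ssize d) b d \<subseteq> edges_on {b..b + ssize d}"
      by (rule order.trans[OF fedges_range(2) edges_on_mono]) auto
    show "fedges (Suc (b + ssize d)) t \<subseteq> edges_on {b + ssize d..<b + ssize (High d t)}"
      by (rule order.trans[OF fedges_range(1) edges_on_mono]) auto
  qed auto
qed (auto simp: interleaving_free_def)

section \<open>Recovering a forest from its edges and marks\<close>

lemma Un_separate_eq:
  assumes "A \<union> B = A' \<union> B'" "A \<subseteq> V" "A' \<subseteq> V" "B \<subseteq> W" "B' \<subseteq> W" "V \<inter> W = {}"
  shows "A = A'" "B = B'"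
  using assms by blast+

lemma edges_on_disjoint: "V \<inter> W \<subseteq> {m} \<Longrightarrow> edges_on V \<inter> edges_on W = {}"
proof -
  assume VW: "V \<inter> W \<subseteq> {m}"
  have False if e: "e \<subseteq> V" "e \<subseteq> W" "card e = 2" for e
  proof -
    have "card e \<le> card {m}" by (rule card_mono) (use e VW in auto)
    then show False using e(3) by simp
  qed
  then show ?thesis unfolding edges_on_def by blast
qed

lemma edges_on_notin: "Z \<subseteq> edges_on V \<Longrightarrow> v \<notin> V \<Longrightarrow> e \<in> Z \<Longrightarrow> v \<notin> e"
  unfolding edges_on_def by blast

text \<open>The edge from \<open>u\<close> to \<open>m\<close> is the only one at \<open>u\<close>,
  which fixes \<open>m\<close>. The rest then splits uniquely, because intervals sharing only
  \<open>m\<close> have no edge in common.\<close>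

lemma insert_edge_eq_iff:
  assumes eq: "insert {u, m} (X \<union> Y) = insert {u, m'} (X' \<union> Y')"
    and X: "X \<subseteq> edges_on {a..m}" and Y: "Y \<subseteq> edges_on {m..<b}"
    and X': "X' \<subseteq> edges_on {a..m'}" and Y': "Y' \<subseteq> edges_on {m'..<b}"
    and u: "u \<notin> {a..<b}" and m: "a \<le> m" "m < b" "a \<le> m'" "m' < b"
  shows "m = m' \<and> X = X' \<and> Y = Y'"
proof -
  have notin: "u \<notin> e" if "e \<in> X \<union> Y \<union> X' \<union> Y'" for e
  proof -
    have "u \<notin> {a..m}" "u \<notin> {m..<b}" "u \<notin> {a..m'}" "u \<notin> {m'..<b}"
      using u m by auto
    then show ?thesis
      using that edges_on_notin[OF X] edges_on_notin[OF Y] edges_on_notin[OF X'] edges_on_notin[OF Y']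
      by blast
  qed
  have "{u, m} \<in> insert {u, m'} (X' \<union> Y')" using eq by blast
  then have m_eq: "m = m'"
    using notin[of "{u, m}"] by (auto simp: doubleton_eq_iff)
  have "X \<union> Y = X' \<union> Y'"
    using eq notin[of "{u, m'}"] unfolding m_eq by (subst (asm) insert_ident) auto
  moreover have "edges_on {a..m} \<inter> edges_on {m..<b} = {}"
    by (rule edges_on_disjoint[of _ _ m]) auto
  ultimately show ?thesis
    using Un_separate_eq[of X Y X' Y'] X Y X' Y' m_eq by blast
qed

text \<open>The constructors of a spine differ in the edges at the vertex \<open>m\<close> entered
  from \<open>u\<close>: \<open>Tip\<close> has no further edge there, \<open>Low\<close> has one in
  the right part only, \<open>High\<close> one in the left part only.\<close>

lemma sedges_Tip_range:
  fixes t t' :: "'f forest" and b :: nat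
  defines "m \<equiv> b + fsize t"
  shows "fedges b t \<subseteq> edges_on {b..m}" "fedges (Suc m) t' \<subseteq> edges_on {m..<b + ssize (Tip t t')}"
    "e \<in> fedges b t \<union> fedges (Suc m) t' \<Longrightarrow> m \<notin> e"
proof -
  show "fedges b t \<subseteq> edges_on {b..m}"
    by (rule order.trans[OF fedges_range(1) edges_on_mono]) (auto simp: m_def)
  show "fedges (Suc m) t' \<subseteq> edges_on {m..<b + ssize (Tip t t')}"
    by (rule order.trans[OF fedges_range(1) edges_on_mono]) (auto simp: m_def)
  show "m \<notin> e" if "e \<in> fedges b t \<union> fedges (Suc m) t'"
    using that edges_on_notin[OF fedges_range(1)[of b t], of m e]
      edges_on_notin[OF fedges_range(1)[of "Suc m" t'], of m e] by (auto simp: m_def)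
qed

lemma root_edge: "{u, root a d} \<in> sedges u a d"
  by (cases d) auto

lemma sedges_Low_range:
  fixes t :: "'f forest" and d :: "'f spine" and b :: nat
  defines "m \<equiv> b + fsize t"
  shows "fedges b t \<subseteq> edges_on {b..m}" "sedges m (Suc m) d \<subseteq> edges_on {m..<b + ssize (Low t d)}"
    "e \<in> fedges b t \<Longrightarrow> m \<notin> e" "\<exists>e\<in>sedges m (Suc m) d. m \<in> e"
proof -
  show "fedges b t \<subseteq> edges_on {b..m}"
    by (rule order.trans[OF fedges_range(1) edges_on_mono]) (auto simp: m_def)
  show "sedges m (Suc m) d \<subseteq> edges_on {m..<b + ssize (Low t d)}"
    by (rule order.trans[OF fedges_range(2) edges_on_mono]) (auto simp: m_def)
  show "m \<notin> e" if "e \<in> fedges b t"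
    using that edges_on_notin[OF fedges_range(1)[of b t], of m e] by (auto simp: m_def)
  show "\<exists>e\<in>sedges m (Suc m) d. m \<in> e"
    using root_edge by (rule bexI[rotated]) simp
qed

lemma sedges_High_range:
  fixes t :: "'f forest" and d :: "'f spine" and b :: nat
  defines "m \<equiv> b + ssize d"
  shows "sedges m b d \<subseteq> edges_on {b..m}" "fedges (Suc m) t \<subseteq> edges_on {m..<b + ssize (High d t)}"
    "\<exists>e\<in>sedges m b d. m \<in> e" "e \<in> fedges (Suc m) t \<Longrightarrow> m \<notin> e"
proof -
  show "sedges m b d \<subseteq> edges_on {b..m}"
    by (rule order.trans[OF fedges_range(2) edges_on_mono]) (auto simp: m_def)
  show "fedges (Suc m) t \<subseteq> edges_on {m..<b + ssize (High d t)}"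
    by (rule order.trans[OF fedges_range(1) edges_on_mono]) (auto simp: m_def)
  show "m \<notin> e" if "e \<in> fedges (Suc m) t"
    using that edges_on_notin[OF fedges_range(1)[of "Suc m" t], of m e] by (auto simp: m_def)
  show "\<exists>e\<in>sedges m b d. m \<in> e"
    using root_edge by (rule bexI[rotated]) simp
qed

text \<open>Structural induction. The edge from \<open>u\<close> locates the next path vertex, the
  further edges there reveal the constructor, and the edges and marks split at that vertex. The
  conclusion \<open>e = e'\<close> carries a mark at the end of a path back to its
  \<open>Path\<close> node.\<close>

lemma decode_inj:
  fixes t t' :: "'f forest" and d d' :: "'f spine"
  assumes h: "inj h"
  shows "fsize t = fsize t' \<Longrightarrow> fedges a t = fedges a t' \<Longrightarrow> fmarks h a t = fmarks h a t' \<Longrightarrow> t = t'"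
    and "ssize d = ssize d' \<Longrightarrow> u \<notin> {b..<b + ssize d} \<Longrightarrow> sedges u b d = sedges u b d' \<Longrightarrow>
         smarks h e b d = smarks h e' b d' \<Longrightarrow> d = d' \<and> e = e'"
proof (induction t and d arbitrary: a t' and e e' u b d')
  case Empty
  then show ?case by (cases t') auto
next
  case (Single x t)
  \<comment> \<open>A singleton has no edge at \<open>a\<close>, whereas a path starting there has
    the edge to its root.\<close>
  have no_edge: "a \<notin> e" if "e \<in> fedges (Suc a) t" for e
    using that edges_on_notin[OF fedges_range(1)[of "Suc a" t], of a e] by auto
  have no_mark: "a \<notin> fmarks h (Suc a) s" for s :: "'f forest"
    using fmarks_range(1)[of h "Suc a" s] by auto
  show ?case
  proof (cases t')
    case Empty
    then show ?thesis using Single.prems by simp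
  next
    case t': (Single y s)
    note sep = Un_separate_eq[OF Single.prems(3)[unfolded t' fmarks.simps], of "{a}" "- {a}"]
    have "(if h x then {a} else {}) = (if h y then {a} else {})"
      by (rule sep(1)) (use no_mark in auto)
    then have "x = y"
      using injD[OF h, of x y] by (auto split: if_splits)
    have marks: "fmarks h (Suc a) t = fmarks h (Suc a) s"
      by (rule sep(2)) (use no_mark in auto)
    have "t = s"
      by (rule Single.IH[OF _ _ marks]) (use Single.prems(1,2) t' in simp_all)
    with \<open>x = y\<close> show ?thesis using t' by simp
  next
    case t': (Path k d)
    then show ?thesis
      using Single.prems(2) no_edge root_edge[of a "Suc a" d] by auto
  qed
next
  case (Path k d)
  have no_mark: "a \<notin> smarks h e (Suc a) s" for e and s :: "'f spine"
    using fmarks_range(2)[of h e "Suc a" s] by auto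
  show ?case
  proof (cases t')
    case Empty
    then show ?thesis using Path.prems by simp
  next
    case t': (Single y s)
    have "a \<notin> e" if "e \<in> fedges (Suc a) s" for e
      using that edges_on_notin[OF fedges_range(1)[of "Suc a" s], of a e] by auto
    then show ?thesis
      using Path.prems(2) root_edge[of a "Suc a" d] t' by auto
  next
    case t': (Path k' s)
    note sep = Un_separate_eq[OF Path.prems(3)[unfolded t' fmarks.simps], of "{a}" "- {a}"]
    have "(if k = First_Marked then {a} else {}) = (if k' = First_Marked then {a} else {})"
      by (rule sep(1)) (use no_mark in auto)
    \<comment> \<open>The mark at \<open>a\<close> settles \<open>First_Marked\<close>, and the flag
      passed to the spine settles \<open>Last_Marked\<close>; together they determine
      \<open>k\<close>.\<close>
    then have first: "k = First_Marked \<longleftrightarrow> k' = First_Marked"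
      by (auto split: if_splits)
    have marks: "smarks h (k = Last_Marked) (Suc a) d = smarks h (k' = Last_Marked) (Suc a) s"
      by (rule sep(2)) (use no_mark in auto)
    have "d = s \<and> (k = Last_Marked) = (k' = Last_Marked)"
      by (rule Path.IH[OF _ _ _ marks, of a]) (use Path.prems(1,2) t' in auto)
    then show ?thesis using first t' by (cases k; cases k') auto
  qed
next
  case (Tip p q)
  let ?m = "b + fsize p"
  note R = sedges_Tip_range(1)[of b p] sedges_Tip_range(2)[of b p q]
      sedges_Tip_range(3)[of _ b p q]
  show ?case
  proof (cases d')
    case d': (Tip p' q')
    note R' = sedges_Tip_range(1)[of b p'] sedges_Tip_range(2)[of b p' q']
      sedges_Tip_range(3)[of _ b p' q']
    have eq: "?m = b + fsize p' \<and> fedges b p = fedges b p'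
        \<and> fedges (Suc ?m) q = fedges (Suc (b + fsize p')) q'"
      by (rule insert_edge_eq_iff[OF Tip.prems(3)[unfolded d' sedges.simps] R(1,2) R'(1)
            R'(2)[folded d' Tip.prems(1)] Tip.prems(2)])
         (use Tip.prems(1) d' in auto)
    then have sizes: "fsize p = fsize p'" "fsize q = fsize q'"
      using Tip.prems(1) d' by auto
    have marks: "fmarks h b p \<union> ((if e then {?m} else {}) \<union> fmarks h (Suc ?m) q)
        = fmarks h b p' \<union> ((if e' then {?m} else {}) \<union> fmarks h (Suc ?m) q')"
      using Tip.prems(4) d' sizes by simp
    have ranges: "fmarks h b p \<subseteq> {..<?m}" "fmarks h b p' \<subseteq> {..<?m}"
      "fmarks h (Suc ?m) q \<subseteq> {Suc ?m..}" "fmarks h (Suc ?m) q' \<subseteq> {Suc ?m..}"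
      using fmarks_range(1)[of h b p] fmarks_range(1)[of h b p']
        fmarks_range(1)[of h "Suc ?m" q] fmarks_range(1)[of h "Suc ?m" q'] sizes by auto
    have m1: "fmarks h b p = fmarks h b p'"
      by (rule Un_separate_eq(1)[OF marks ranges(1,2), of "{?m..}"]) (use ranges in auto)
    have m2: "(if e then {?m} else {}) \<union> fmarks h (Suc ?m) q
        = (if e' then {?m} else {}) \<union> fmarks h (Suc ?m) q'"
      by (rule Un_separate_eq(2)[OF marks ranges(1,2), of "{?m..}"]) (use ranges in auto)
    have m3: "fmarks h (Suc ?m) q = fmarks h (Suc ?m) q'"
      by (rule Un_separate_eq(2)[OF m2 _ _ ranges(3,4), of "{?m}"]) auto
    have "?m \<notin> fmarks h (Suc ?m) q'" using ranges(4) by auto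
    then have e: "e = e'" using m2 unfolding m3 by (auto split: if_splits)
    have "p = p'" by (rule Tip.IH(1)[OF sizes(1) _ m1]) (use eq sizes in simp)
    moreover have "q = q'" by (rule Tip.IH(2)[OF sizes(2) _ m3]) (use eq sizes in simp)
    ultimately show ?thesis using d' e by simp
  next
    case d': (Low p' s)
    note R' = sedges_Low_range(1)[of b p'] sedges_Low_range(2)[of b p' s]
      sedges_Low_range(3)[of _ b p'] sedges_Low_range(4)[of b p' s]
    have "?m = b + fsize p' \<and> fedges b p = fedges b p'
        \<and> fedges (Suc ?m) q = sedges (b + fsize p') (Suc (b + fsize p')) s"
      by (rule insert_edge_eq_iff[OF Tip.prems(3)[unfolded d' sedges.simps] R(1,2) R'(1)
            R'(2)[folded d' Tip.prems(1)] Tip.prems(2)])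
         (use Tip.prems(1) d' in auto)
    \<comment> \<open>Contradiction: under \<open>Tip\<close> no edge of the right part meets
      \<open>?m\<close>, under \<open>Low\<close> one does. The other mismatched constructors are
      excluded likewise.\<close>
    then show ?thesis using R(3) R'(4) by (metis Un_iff)
  next
    case d': (High s p')
    note R' = sedges_High_range(1)[of b s] sedges_High_range(2)[of b s p']
      sedges_High_range(3)[of b s] sedges_High_range(4)[of _ b s p']
    have "?m = b + ssize s \<and> fedges b p = sedges (b + ssize s) b s
        \<and> fedges (Suc ?m) q = fedges (Suc (b + ssize s)) p'"
      by (rule insert_edge_eq_iff[OF Tip.prems(3)[unfolded d' sedges.simps] R(1,2) R'(1)
            R'(2)[folded d' Tip.prems(1)] Tip.prems(2)])
         (use Tip.prems(1) d' in auto)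
    then show ?thesis using R(3) R'(3) by (metis Un_iff)
  qed
next
  case (Low p s)
  let ?m = "b + fsize p"
  note R = sedges_Low_range(1)[of b p] sedges_Low_range(2)[of b p s]
      sedges_Low_range(3)[of _ b p] sedges_Low_range(4)[of b p s]
  show ?case
  proof (cases d')
    case d': (Tip p' q')
    note R' = sedges_Tip_range(1)[of b p'] sedges_Tip_range(2)[of b p' q']
      sedges_Tip_range(3)[of _ b p' q']
    have "?m = b + fsize p' \<and> fedges b p = fedges b p'
        \<and> sedges ?m (Suc ?m) s = fedges (Suc (b + fsize p')) q'"
      by (rule insert_edge_eq_iff[OF Low.prems(3)[unfolded d' sedges.simps] R(1,2) R'(1)
            R'(2)[folded d' Low.prems(1)] Low.prems(2)])
         (use Low.prems(1) d' in auto)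
    then show ?thesis using R(4) R'(3) by (metis Un_iff)
  next
    case d': (Low p' s')
    note R' = sedges_Low_range(1)[of b p'] sedges_Low_range(2)[of b p' s']
      sedges_Low_range(3)[of _ b p'] sedges_Low_range(4)[of b p' s']
    have eq: "?m = b + fsize p' \<and> fedges b p = fedges b p'
        \<and> sedges ?m (Suc ?m) s = sedges (b + fsize p') (Suc (b + fsize p')) s'"
      by (rule insert_edge_eq_iff[OF Low.prems(3)[unfolded d' sedges.simps] R(1,2) R'(1)
            R'(2)[folded d' Low.prems(1)] Low.prems(2)])
         (use Low.prems(1) d' in auto)
    then have sizes: "fsize p = fsize p'" "ssize s = ssize s'"
      using Low.prems(1) d' by auto
    have marks: "fmarks h b p \<union> smarks h e (Suc ?m) s = fmarks h b p' \<union> smarks h e' (Suc ?m) s'"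
      using Low.prems(4) d' sizes by simp
    have ranges: "fmarks h b p \<subseteq> {..<?m}" "fmarks h b p' \<subseteq> {..<?m}"
      "smarks h e (Suc ?m) s \<subseteq> {Suc ?m..}" "smarks h e' (Suc ?m) s' \<subseteq> {Suc ?m..}"
      using fmarks_range(1)[of h b p] fmarks_range(1)[of h b p']
        fmarks_range(2)[of h e "Suc ?m" s] fmarks_range(2)[of h e' "Suc ?m" s'] sizes by auto
    have m1: "fmarks h b p = fmarks h b p'" and m2: "smarks h e (Suc ?m) s = smarks h e' (Suc ?m) s'"
      by (rule Un_separate_eq[OF marks ranges]; auto)+
    have "p = p'" by (rule Low.IH(1)[OF sizes(1) _ m1]) (use eq sizes in simp)
    moreover have "s = s' \<and> e = e'"
      by (rule Low.IH(2)[OF sizes(2) _ _ m2, of ?m]) (use eq sizes in simp_all)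
    ultimately show ?thesis using d' by simp
  next
    case d': (High s' p')
    note R' = sedges_High_range(1)[of b s'] sedges_High_range(2)[of b s' p']
      sedges_High_range(3)[of b s'] sedges_High_range(4)[of _ b s' p']
    have "?m = b + ssize s' \<and> fedges b p = sedges (b + ssize s') b s'
        \<and> sedges ?m (Suc ?m) s = fedges (Suc (b + ssize s')) p'"
      by (rule insert_edge_eq_iff[OF Low.prems(3)[unfolded d' sedges.simps] R(1,2) R'(1)
            R'(2)[folded d' Low.prems(1)] Low.prems(2)])
         (use Low.prems(1) d' in auto)
    then show ?thesis using R(3) R'(3) by (metis Un_iff)
  qed
next
  case (High s p)
  let ?m = "b + ssize s"
  note R = sedges_High_range(1)[of b s] sedges_High_range(2)[of b s p]
      sedges_High_range(3)[of b s] sedges_High_range(4)[of _ b s p]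
  show ?case
  proof (cases d')
    case d': (Tip p' q')
    note R' = sedges_Tip_range(1)[of b p'] sedges_Tip_range(2)[of b p' q']
      sedges_Tip_range(3)[of _ b p' q']
    have "?m = b + fsize p' \<and> sedges ?m b s = fedges b p'
        \<and> fedges (Suc ?m) p = fedges (Suc (b + fsize p')) q'"
      by (rule insert_edge_eq_iff[OF High.prems(3)[unfolded d' sedges.simps] R(1,2) R'(1)
            R'(2)[folded d' High.prems(1)] High.prems(2)])
         (use High.prems(1) d' in auto)
    then show ?thesis using R(3) R'(3) by (metis Un_iff)
  next
    case d': (Low p' s')
    note R' = sedges_Low_range(1)[of b p'] sedges_Low_range(2)[of b p' s']
      sedges_Low_range(3)[of _ b p'] sedges_Low_range(4)[of b p' s']
    have "?m = b + fsize p' \<and> sedges ?m b s = fedges b p'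
        \<and> fedges (Suc ?m) p = sedges (b + fsize p') (Suc (b + fsize p')) s'"
      by (rule insert_edge_eq_iff[OF High.prems(3)[unfolded d' sedges.simps] R(1,2) R'(1)
            R'(2)[folded d' High.prems(1)] High.prems(2)])
         (use High.prems(1) d' in auto)
    then show ?thesis using R(3) R'(3) by (metis Un_iff)
  next
    case d': (High s' p')
    note R' = sedges_High_range(1)[of b s'] sedges_High_range(2)[of b s' p']
      sedges_High_range(3)[of b s'] sedges_High_range(4)[of _ b s' p']
    have eq: "?m = b + ssize s' \<and> sedges ?m b s = sedges (b + ssize s') b s'
        \<and> fedges (Suc ?m) p = fedges (Suc (b + ssize s')) p'"
      by (rule insert_edge_eq_iff[OF High.prems(3)[unfolded d' sedges.simps] R(1,2) R'(1)
            R'(2)[folded d' High.prems(1)] High.prems(2)])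
         (use High.prems(1) d' in auto)
    then have sizes: "ssize s = ssize s'" "fsize p = fsize p'"
      using High.prems(1) d' by auto
    have marks: "smarks h e b s \<union> fmarks h (Suc ?m) p = smarks h e' b s' \<union> fmarks h (Suc ?m) p'"
      using High.prems(4) d' sizes by simp
    have ranges: "smarks h e b s \<subseteq> {..<?m}" "smarks h e' b s' \<subseteq> {..<?m}"
      "fmarks h (Suc ?m) p \<subseteq> {Suc ?m..}" "fmarks h (Suc ?m) p' \<subseteq> {Suc ?m..}"
      using fmarks_range(1)[of h "Suc ?m" p] fmarks_range(1)[of h "Suc ?m" p']
        fmarks_range(2)[of h e b s] fmarks_range(2)[of h e' b s'] sizes by auto
    have m1: "smarks h e b s = smarks h e' b s'" and m2: "fmarks h (Suc ?m) p = fmarks h (Suc ?m) p'"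
      by (rule Un_separate_eq[OF marks ranges]; auto)+
    have "p = p'" by (rule High.IH(2)[OF sizes(2) _ m2]) (use eq sizes in simp)
    moreover have "s = s' \<and> e = e'"
      by (rule High.IH(1)[OF sizes(1) _ _ m1, of ?m]) (use eq sizes in simp_all)
    ultimately show ?thesis using d' by simp
  qed
qed

subsection \<open>Geometry of the double chain\<close>

lemma orient_segment:
  "orient p q ((1 - t) *\<^sub>R a + t *\<^sub>R b) = (1 - t) * orient p q a + t * orient p q b"
  by (simp add: orient_def algebra_simps)

lemma orient_degenerate [simp]: "orient p q p = 0" "orient p q q = 0"
  by (simp_all add: orient_def algebra_simps)

lemma segment_cases:
  assumes "x \<in> convex hull {a, b :: point}"
  obtains "x = a" | "x = b" | t where "0 < t" "t < 1" "x = (1 - t) *\<^sub>R a + t *\<^sub>R b"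
proof -
  from assms obtain t where t: "0 \<le> t" "t \<le> 1" "x = (1 - t) *\<^sub>R a + t *\<^sub>R b"
    by (auto simp: closed_segment_def simp flip: segment_convex_hull)
  then consider "t = 0" | "t = 1" | "0 < t" "t < 1" by linarith
  then show thesis by cases (use t that in auto)
qed

lemma segment_on_line: "x \<in> convex hull {p, q} \<Longrightarrow> orient p q x = 0"
  by (erule segment_cases) (auto simp: orient_segment)

lemma segment_fst:
  fixes a b x :: point
  assumes "x \<in> convex hull {a, b}" "fst a < fst b"
  shows "fst a \<le> fst x \<and> fst x \<le> fst b \<and> (fst x = fst a \<longrightarrow> x = a) \<and> (fst x = fst b \<longrightarrow> x = b)"
  using assms(1)
proof (cases rule: segment_cases)
  case (3 t)
  then have "fst x = (1 - t) * fst a + t * fst b"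
    by simp
  then have "fst x - fst a = t * (fst b - fst a)" "fst b - fst x = (1 - t) * (fst b - fst a)"
    by (simp_all add: algebra_simps)
  moreover have "t * (fst b - fst a) > 0" "(1 - t) * (fst b - fst a) > 0"
    using 3 assms by simp_all
  ultimately show ?thesis by linarith
qed (use assms in auto)

lemma below_orient: "fst p < fst q \<Longrightarrow> strictly_below_line p q r \<longleftrightarrow> orient p q r < 0"
  and above_orient: "fst p < fst q \<Longrightarrow> strictly_above_line p q r \<longleftrightarrow> orient p q r > 0"
  by (simp_all add: strictly_below_line_def strictly_above_line_def orient_def field_simps)

text \<open>The determinant is affine along the segment, so its sign is strict in the interior once
  one end is off the line. The factor \<sigma> chooses the side.\<close>

lemma segment_orient_sign:
  assumes "x \<in> convex hull {a, b}" "\<sigma> * orient p q a \<ge> 0" "\<sigma> * orient p q b \<ge> 0"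
    "\<sigma> * orient p q a > 0 \<or> \<sigma> * orient p q b > 0"
  shows "\<sigma> * orient p q x > 0 \<or> (x = a \<or> x = b) \<and> \<sigma> * orient p q x = 0"
  using assms(1)
proof (cases rule: segment_cases)
  case (3 t)
  have "\<sigma> * orient p q x = (1 - t) * (\<sigma> * orient p q a) + t * (\<sigma> * orient p q b)"
    unfolding 3(3) orient_segment by (simp only: distrib_left mult.left_commute)
  moreover have "(1 - t) * (\<sigma> * orient p q a) \<ge> 0" "t * (\<sigma> * orient p q b) \<ge> 0"
    using 3 assms by simp_all
  moreover have "(1 - t) * (\<sigma> * orient p q a) > 0 \<or> t * (\<sigma> * orient p q b) > 0"
    using 3 assms(4) mult_pos_pos[of "1 - t" "\<sigma> * orient p q a"] mult_pos_pos[of t "\<sigma> * orient p q b"]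
    by auto
  ultimately show ?thesis by linarith
qed (use assms in auto)

section \<open>Criteria for two segments not to cross\<close>

definition uncrossed :: "point set \<Rightarrow> point set \<Rightarrow> bool" where
  "uncrossed e f \<longleftrightarrow> convex hull e \<inter> convex hull f \<subseteq> e \<inter> f"

lemma non_crossing_iff: "non_crossing E \<longleftrightarrow> (\<forall>e\<in>E. \<forall>f\<in>E. e \<noteq> f \<longrightarrow> uncrossed e f)"
  by (simp add: non_crossing_def uncrossed_def)

lemma uncrossed_sym: "uncrossed e f \<Longrightarrow> uncrossed f e"
  unfolding uncrossed_def by blast

text \<open>Each segment meets the separating line at most in one of its ends, so a common point is
  an end of both.\<close>

lemma uncrossed_separated:
  assumes ab: "\<sigma> * orient p q a \<ge> 0" "\<sigma> * orient p q b \<ge> 0"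
      "\<sigma> * orient p q a > 0 \<or> \<sigma> * orient p q b > 0"
    and cd: "\<sigma> * orient p q c \<le> 0" "\<sigma> * orient p q d \<le> 0"
      "\<sigma> * orient p q c < 0 \<or> \<sigma> * orient p q d < 0"
  shows "uncrossed {a, b} {c, d}"
  unfolding uncrossed_def
proof
  fix x assume "x \<in> convex hull {a, b} \<inter> convex hull {c, d}"
  then have x: "x \<in> convex hull {a, b}" "x \<in> convex hull {c, d}" by auto
  have "\<sigma> * orient p q x > 0 \<or> (x = a \<or> x = b) \<and> \<sigma> * orient p q x = 0"
    by (rule segment_orient_sign[OF x(1) ab])
  moreover have "- \<sigma> * orient p q x > 0 \<or> (x = c \<or> x = d) \<and> - \<sigma> * orient p q x = 0"
    by (rule segment_orient_sign[OF x(2)]) (use cd in auto)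
  ultimately show "x \<in> {a, b} \<inter> {c, d}" by auto
qed

text \<open>Here the line carries the second segment itself; by \<open>touch\<close>, an end of the
  first segment lying on it is an end of the second.\<close>

lemma uncrossed_supporting:
  assumes ab: "\<sigma> * orient p q a \<ge> 0" "\<sigma> * orient p q b \<ge> 0"
      "\<sigma> * orient p q a > 0 \<or> \<sigma> * orient p q b > 0"
    and touch: "orient p q a = 0 \<Longrightarrow> a = p \<or> a = q" "orient p q b = 0 \<Longrightarrow> b = p \<or> b = q"
    and "\<sigma> \<noteq> 0"
  shows "uncrossed {a, b} {p, q}"
  unfolding uncrossed_def
proof
  fix x assume "x \<in> convex hull {a, b} \<inter> convex hull {p, q}"
  then have x: "x \<in> convex hull {a, b}" "x \<in> convex hull {p, q}" by auto
  have "\<sigma> * orient p q x > 0 \<or> (x = a \<or> x = b) \<and> \<sigma> * orient p q x = 0"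
    by (rule segment_orient_sign[OF x(1) ab])
  moreover have "orient p q x = 0" by (rule segment_on_line[OF x(2)])
  ultimately show "x \<in> {a, b} \<inter> {p, q}" using touch by auto
qed

text \<open>With \<sigma> = 1 this is a cup chain and with \<sigma> = -1 a cap chain, so both are
  handled at once.\<close>

definition chain :: "real \<Rightarrow> point list \<Rightarrow> bool" where
  "chain \<sigma> ps \<longleftrightarrow> \<sigma> \<noteq> 0 \<and> x_sorted ps \<and>
     (\<forall>i j k. i < j \<and> j < k \<and> k < length ps \<longrightarrow> \<sigma> * orient (ps ! i) (ps ! j) (ps ! k) > 0)"

lemma chain_fst: "chain \<sigma> ps \<Longrightarrow> i < j \<Longrightarrow> j < length ps \<Longrightarrow> fst (ps ! i) < fst (ps ! j)"
  by (simp add: chain_def x_sorted_def)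

lemma chain_inj: "chain \<sigma> ps \<Longrightarrow> inj_on (nth ps) {..<length ps}"
  by (rule linorder_inj_onI') (auto dest: chain_fst)

lemma chain_orient:
  assumes "chain \<sigma> ps" "i < j" "j < k" "k < length ps"
  shows "\<sigma> * orient (ps ! i) (ps ! j) (ps ! k) > 0" "\<sigma> * orient (ps ! j) (ps ! k) (ps ! i) > 0"
    "- \<sigma> * orient (ps ! i) (ps ! k) (ps ! j) > 0"
proof -
  show *: "\<sigma> * orient (ps ! i) (ps ! j) (ps ! k) > 0"
    using assms by (simp add: chain_def)
  show "\<sigma> * orient (ps ! j) (ps ! k) (ps ! i) > 0"
    "- \<sigma> * orient (ps ! i) (ps ! k) (ps ! j) > 0"
    using * by (simp_all add: orient_def algebra_simps)
qed

text \<open>The line of the outer chord supports the inner one: by convexity, the vertices strictly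
  between its ends lie strictly on one side.\<close>

lemma chain_uncrossed_nested:
  assumes ps: "chain \<sigma> ps" and less: "i \<le> j" "j < l" "l \<le> k" "k < length ps" "i < j \<or> l < k"
  shows "uncrossed {ps ! j, ps ! l} {ps ! i, ps ! k}"
proof -
  have *: "if m = i \<or> m = k then orient (ps ! i) (ps ! k) (ps ! m) = 0
      else - \<sigma> * orient (ps ! i) (ps ! k) (ps ! m) > 0" if "i \<le> m" "m \<le> k" for m
    using chain_orient(3)[OF ps, of i m k] that less(4) by auto
  have s: "\<sigma> \<noteq> 0" using ps by (simp add: chain_def)
  show ?thesis
  proof (rule uncrossed_supporting[of "- \<sigma>"])
    show "- \<sigma> * orient (ps ! i) (ps ! k) (ps ! j) \<ge> 0" "- \<sigma> * orient (ps ! i) (ps ! k) (ps ! l) \<ge> 0"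
      using *[of j] *[of l] less by (auto split: if_splits)
    show "- \<sigma> * orient (ps ! i) (ps ! k) (ps ! j) > 0 \<or> - \<sigma> * orient (ps ! i) (ps ! k) (ps ! l) > 0"
      using *[of j] *[of l] less by (auto split: if_splits)
    show "ps ! j = ps ! i \<or> ps ! j = ps ! k" if "orient (ps ! i) (ps ! k) (ps ! j) = 0"
      using *[of j] less that by (auto split: if_splits)
    show "ps ! l = ps ! i \<or> ps ! l = ps ! k" if "orient (ps ! i) (ps ! k) (ps ! l) = 0"
      using *[of l] less that by (auto split: if_splits)
  qed (use s in simp)
qed

text \<open>The horizontal ranges of the chords meet at most in the abscissa of a shared
  vertex.\<close>

lemma chain_uncrossed_apart:
  assumes ps: "chain \<sigma> ps" and less: "i < k" "k \<le> j" "j < l" "l < length ps"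
  shows "uncrossed {ps ! i, ps ! k} {ps ! j, ps ! l}"
  unfolding uncrossed_def
proof
  fix x assume x: "x \<in> convex hull {ps ! i, ps ! k} \<inter> convex hull {ps ! j, ps ! l}"
  have 1: "fst x \<le> fst (ps ! k)" "fst x = fst (ps ! k) \<longrightarrow> x = ps ! k"
    using segment_fst[of x "ps ! i" "ps ! k"] chain_fst[OF ps, of i k] x less by auto
  have 2: "fst (ps ! j) \<le> fst x" "fst x = fst (ps ! j) \<longrightarrow> x = ps ! j"
    using segment_fst[of x "ps ! j" "ps ! l"] chain_fst[OF ps, of j l] x less by auto
  show "x \<in> {ps ! i, ps ! k} \<inter> {ps ! j, ps ! l}"
  proof (cases "k = j")
    case True
    then show ?thesis using 1 2 by auto
  next
    case False
    then have "fst (ps ! k) < fst (ps ! j)" using chain_fst[OF ps, of k j] less by auto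
    then show ?thesis using 1 2 by linarith
  qed
qed

lemma chain_uncrossed:
  assumes ps: "chain \<sigma> ps" and E: "interleaving_free E"
    and ik: "{i, k} \<in> E" "i < k" "k < length ps"
    and jl: "{j, l} \<in> E" "j < l" "l < length ps" and ne: "(i, k) \<noteq> (j, l)"
  shows "uncrossed {ps ! i, ps ! k} {ps ! j, ps ! l}"
proof -
  have "\<not> (i < j \<and> j < k \<and> k < l)" "\<not> (j < i \<and> i < l \<and> l < k)"
    using E ik(1) jl(1) unfolding interleaving_free_def by blast+
  moreover have "i \<noteq> j \<or> k \<noteq> l" using ne by simp
  \<comment> \<open>Chords without interleaving lie side by side or one spans the other, common ends
    allowed.\<close>
  ultimately have "k \<le> j \<or> l \<le> i \<or> (i \<le> j \<and> l \<le> k \<and> (i < j \<or> l < k))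
      \<or> (j \<le> i \<and> k \<le> l \<and> (j < i \<or> k < l))"
    by presburger
  then consider "k \<le> j" | "l \<le> i" | "i \<le> j" "l \<le> k" "i < j \<or> l < k" | "j \<le> i" "k \<le> l" "j < i \<or> k < l"
    by blast
  then show ?thesis
  proof cases
    case 1
    show ?thesis by (rule chain_uncrossed_apart[OF ps]) (use 1 ik jl in auto)
  next
    case 2
    show ?thesis by (rule uncrossed_sym, rule chain_uncrossed_apart[OF ps]) (use 2 ik jl in auto)
  next
    case 3
    show ?thesis by (rule uncrossed_sym, rule chain_uncrossed_nested[OF ps]) (use 3 ik jl in auto)
  next
    case 4
    show ?thesis by (rule chain_uncrossed_nested[OF ps]) (use 4 ik jl in auto)
  qed
qed

text \<open>If the segment to \<open>v\<close> starts between the ends of the chord, the line of the chord separates the two;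
  otherwise the line through its start and the nearer end of the chord does.\<close>

lemma chain_uncrossed_bridge:
  assumes ps: "chain \<sigma> ps"
    and v: "\<And>i k. i < k \<Longrightarrow> k < length ps \<Longrightarrow> \<sigma> * orient (ps ! i) (ps ! k) v < 0"
    and less: "i < k" "k < length ps" "j < length ps"
  shows "uncrossed {ps ! i, ps ! k} {ps ! j, v}"
proof -
  have s: "\<sigma> \<noteq> 0" using ps by (simp add: chain_def)
  consider "i \<le> j" "j \<le> k" | "k < j" | "j < i" by linarith
  then show ?thesis
  proof cases
    case 1
    have *: "if j = i \<or> j = k then orient (ps ! i) (ps ! k) (ps ! j) = 0
        else - \<sigma> * orient (ps ! i) (ps ! k) (ps ! j) > 0"
      using chain_orient(3)[OF ps, of i j k] 1 less by auto
    have vk: "- \<sigma> * orient (ps ! i) (ps ! k) v > 0" using v[of i k] less by simp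
    have "uncrossed {ps ! j, v} {ps ! i, ps ! k}"
    proof (rule uncrossed_supporting[of "- \<sigma>"])
      show "- \<sigma> * orient (ps ! i) (ps ! k) (ps ! j) \<ge> 0" using * by (auto split: if_splits)
      show "ps ! j = ps ! i \<or> ps ! j = ps ! k" if "orient (ps ! i) (ps ! k) (ps ! j) = 0"
        using * that by (auto split: if_splits)
    qed (use s vk in auto)
    then show ?thesis by (rule uncrossed_sym)
  next
    case 2
    show ?thesis
      by (rule uncrossed_separated[of \<sigma> "ps ! k" "ps ! j"])
        (use chain_orient(2)[OF ps, of i k j] v[of k j] 2 less in auto)
  next
    case 3
    show ?thesis
      by (rule uncrossed_separated[of \<sigma> "ps ! j" "ps ! i"])
        (use chain_orient(1)[OF ps, of j i k] v[of j i] 3 less in auto)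
  qed
qed

text \<open>Brings both chains into one form: with \<sigma> = 1 for \<open>U\<close> and \<sigma> =
  -1 for \<open>L\<close>, the points of the opposite chain have the sign asked for by
  \<open>chain_uncrossed_bridge\<close>.\<close>

lemma double_chain_chains:
  assumes "double_chain n U L"
  shows "chain 1 U" "chain (- 1) L" "length U = n" "length L = n" "set U \<inter> set L = {}"
    "i < k \<Longrightarrow> k < n \<Longrightarrow> v \<in> set L \<Longrightarrow> 1 * orient (U ! i) (U ! k) v < 0"
    "i < k \<Longrightarrow> k < n \<Longrightarrow> v \<in> set U \<Longrightarrow> - 1 * orient (L ! i) (L ! k) v < 0"
proof -
  show chains: "chain 1 U" "chain (- 1) L" and len: "length U = n" "length L = n" and "set U \<inter> set L = {}"
    using assms by (auto simp: double_chain_def chain_def cup_chain_def cap_chain_def)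
  show "1 * orient (U ! i) (U ! k) v < 0" if *: "i < k" "k < n" "v \<in> set L"
  proof -
    have "fst (U ! i) < fst (U ! k)" using chain_fst[OF chains(1)] * len by simp
    moreover have "U ! i \<in> set U" "U ! k \<in> set U" using * len by simp_all
    ultimately show ?thesis
      using assms * by (simp add: double_chain_def below_orient)
  qed
  show "- 1 * orient (L ! i) (L ! k) v < 0" if *: "i < k" "k < n" "v \<in> set U"
  proof -
    have "fst (L ! i) < fst (L ! k)" using chain_fst[OF chains(2)] * len by simp
    moreover have "L ! i \<in> set L" "L ! k \<in> set L" using * len by simp_all
    ultimately show ?thesis
      using assms * by (simp add: double_chain_def above_orient)
  qed
qed

text \<open>The line through \<open>U ! i\<close> and \<open>L ! j'\<close> separates the bridges:
  it contains one end of each, and the other two ends lie on opposite sides.\<close>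

lemma double_chain_uncrossed_bridges:
  assumes dc: "double_chain n U L" and less: "i < i'" "i' < n" "j < j'" "j' < n"
  shows "uncrossed {U ! i', L ! j'} {U ! i, L ! j}"
proof -
  note D = double_chain_chains[OF dc]
  have mem: "U ! i \<in> set U" "L ! j' \<in> set L" using less D(3,4) by simp_all
  have "orient (U ! i) (U ! i') (L ! j') < 0" using D(6)[OF less(1,2) mem(2)] by simp
  then have "orient (U ! i) (L ! j') (U ! i') > 0" by (simp add: orient_def algebra_simps)
  moreover have "orient (L ! j) (L ! j') (U ! i) > 0" using D(7)[OF less(3,4) mem(1)] by simp
  then have "orient (U ! i) (L ! j') (L ! j) < 0" by (simp add: orient_def algebra_simps)
  ultimately show ?thesis
    by (intro uncrossed_separated[of 1 "U ! i" "L ! j'"]) simp_all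
qed

lemma edges_on_obtain:
  assumes "e \<in> edges_on {..<n}"
  obtains i k where "e = {i, k}" "i < k" "k < n"
proof -
  from assms obtain x y where "e = {x, y}" "x \<noteq> y" "x < n" "y < n"
    by (auto simp: edges_on_def card_2_iff)
  then show thesis using that[of x y] that[of y x] by (cases "x < y") (auto simp: insert_commute)
qed

lemma double_chain_non_crossing:
  assumes dc: "double_chain n U L"
    and E: "E \<subseteq> edges_on {..<n}" "interleaving_free E"
    and F: "F \<subseteq> edges_on {..<n}" "interleaving_free F"
    and M: "M \<subseteq> {..<n}" "strict_mono_on M f" "f ` M \<subseteq> {..<n}"
  shows "non_crossing (image (nth U) ` E \<union> image (nth L) ` F \<union> {{U ! i, L ! f i} | i. i \<in> M})"
proof -
  note D = double_chain_chains[OF dc]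
  have UU: "uncrossed e e'" if "e \<in> image (nth U) ` E" "e' \<in> image (nth U) ` E" "e \<noteq> e'" for e e'
  proof -
    from that obtain a a' where *: "a \<in> E" "a' \<in> E" "e = (!) U ` a" "e' = (!) U ` a'" by blast
    obtain i k where a: "a = {i, k}" "i < k" "k < n"
      by (rule edges_on_obtain[OF subsetD[OF E(1) *(1)]])
    obtain j l where a': "a' = {j, l}" "j < l" "l < n"
      by (rule edges_on_obtain[OF subsetD[OF E(1) *(2)]])
    have "(i, k) \<noteq> (j, l)" using that(3) * a a' by auto
    then show ?thesis
      using chain_uncrossed[OF D(1) E(2), of i k j l] * a a' D(3) by simp
  qed
  have LL: "uncrossed e e'" if "e \<in> image (nth L) ` F" "e' \<in> image (nth L) ` F" "e \<noteq> e'" for e e'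
  proof -
    from that obtain a a' where *: "a \<in> F" "a' \<in> F" "e = (!) L ` a" "e' = (!) L ` a'" by blast
    obtain i k where a: "a = {i, k}" "i < k" "k < n"
      by (rule edges_on_obtain[OF subsetD[OF F(1) *(1)]])
    obtain j l where a': "a' = {j, l}" "j < l" "l < n"
      by (rule edges_on_obtain[OF subsetD[OF F(1) *(2)]])
    have "(i, k) \<noteq> (j, l)" using that(3) * a a' by auto
    then show ?thesis
      using chain_uncrossed[OF D(2) F(2), of i k j l] * a a' D(4) by simp
  qed
  have UL: "uncrossed e e'" if "e \<in> image (nth U) ` E" "e' \<in> image (nth L) ` F" for e e'
  proof -
    from that obtain a a' where *: "a \<in> E" "a' \<in> F" "e = (!) U ` a" "e' = (!) L ` a'" by blast
    obtain i k where a: "a = {i, k}" "i < k" "k < n"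
      by (rule edges_on_obtain[OF subsetD[OF E(1) *(1)]])
    obtain j l where a': "a' = {j, l}" "j < l" "l < n"
      by (rule edges_on_obtain[OF subsetD[OF F(1) *(2)]])
    \<comment> \<open>The line of an upper chord leaves the lower chord strictly on one side, so the
      touching conditions hold vacuously.\<close>
    have "L ! j \<in> set L" "L ! l \<in> set L" using a' D(4) by simp_all
    then have "uncrossed {L ! j, L ! l} {U ! i, U ! k}"
      using D(6)[OF a(2,3), of "L ! j"] D(6)[OF a(2,3), of "L ! l"]
      by (intro uncrossed_supporting[of "- 1"]) auto
    then show ?thesis using * a a' by (simp add: uncrossed_sym)
  qed
  have UB: "uncrossed e {U ! m, L ! f m}" if "e \<in> image (nth U) ` E" "m \<in> M" for e m
  proof -
    from that obtain a where *: "a \<in> E" "e = (!) U ` a" by blast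
    obtain i k where a: "a = {i, k}" "i < k" "k < n"
      by (rule edges_on_obtain[OF subsetD[OF E(1) *(1)]])
    have "L ! f m \<in> set L" "m < n" using that M D(4) by auto
    then have "uncrossed {U ! i, U ! k} {U ! m, L ! f m}"
      using D(3,6) a by (intro chain_uncrossed_bridge[OF D(1)]) auto
    then show ?thesis using * a by simp
  qed
  have LB: "uncrossed e {U ! m, L ! f m}" if "e \<in> image (nth L) ` F" "m \<in> M" for e m
  proof -
    from that obtain a where *: "a \<in> F" "e = (!) L ` a" by blast
    obtain i k where a: "a = {i, k}" "i < k" "k < n"
      by (rule edges_on_obtain[OF subsetD[OF F(1) *(1)]])
    have "U ! m \<in> set U" "f m < n" using that M D(3) by auto
    then have "uncrossed {L ! i, L ! k} {L ! f m, U ! m}"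
      using D(4,7) a by (intro chain_uncrossed_bridge[OF D(2)]) auto
    then show ?thesis using * a by (simp add: insert_commute)
  qed
  have BB': "uncrossed {U ! m', L ! f m'} {U ! m, L ! f m}" if "m \<in> M" "m' \<in> M" "m < m'" for m m'
    by (rule double_chain_uncrossed_bridges[OF dc]) (use that M in \<open>auto simp: strict_mono_on_def\<close>)
  have BB: "uncrossed e e'" if "e \<in> {{U ! i, L ! f i} | i. i \<in> M}" "e' \<in> {{U ! i, L ! f i} | i. i \<in> M}"
    "e \<noteq> e'" for e e'
  proof -
    from that obtain m m' where *: "m \<in> M" "m' \<in> M" "e = {U ! m, L ! f m}" "e' = {U ! m', L ! f m'}"
      by blast
    then have "m \<noteq> m'" using that(3) by auto
    then show ?thesis
      using BB'[of m m'] BB'[of m' m] * uncrossed_sym by (metis linorder_neqE_nat)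
  qed
  have uncrossed: "uncrossed e e'" if "e \<in> image (nth U) ` E \<union> image (nth L) ` F \<union> {{U ! i, L ! f i} | i. i \<in> M}"
    "e' \<in> image (nth U) ` E \<union> image (nth L) ` F \<union> {{U ! i, L ! f i} | i. i \<in> M}" "e \<noteq> e'" for e e'
  proof -
    have UB2: "uncrossed e e'" if "e \<in> image (nth U) ` E" "e' \<in> {{U ! i, L ! f i} | i. i \<in> M}" for e e'
      using that UB by blast
    have LB2: "uncrossed e e'" if "e \<in> image (nth L) ` F" "e' \<in> {{U ! i, L ! f i} | i. i \<in> M}" for e e'
      using that LB by blast
    note UL' = uncrossed_sym[OF UL] and UB' = uncrossed_sym[OF UB2] and LB' = uncrossed_sym[OF LB2]
    show ?thesis
      using that
      by (elim UnE)
        ((rule UU; assumption) | (rule LL; assumption) | (rule BB; assumption)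
         | (rule UL; assumption) | (rule UB2; assumption) | (rule LB2; assumption)
         | (rule UL'; assumption) | (rule UB'; assumption) | (rule LB'; assumption))+
  qed
  show ?thesis
    unfolding non_crossing_iff by (intro ballI impI) (rule uncrossed)
qed

subsection \<open>Gluing two forests\<close>

text \<open>The inverse of the increasing enumeration of \<open>M\<close>, followed by that of
  \<open>N\<close>.\<close>

lemma ex_strict_mono_bij:
  fixes M N :: "nat set"
  assumes "finite M" "finite N" "card M = card N"
  obtains f where "strict_mono_on M f" "bij_betw f M N"
proof -
  obtain h where h: "bij_betw h {..<card M} M" "strict_mono_on {..<card M} h"
    using ex_bij_betw_strict_mono_card[OF assms(1)] .
  obtain k where k: "bij_betw k {..<card M} N" "strict_mono_on {..<card M} k"
    using ex_bij_betw_strict_mono_card[OF assms(2)] assms(3) by metis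
  define g where "g = the_inv_into {..<card M} h"
  have g: "bij_betw g M {..<card M}"
    unfolding g_def by (rule bij_betw_the_inv_into[OF h(1)])
  have hg: "h (g i) = i" if "i \<in> M" for i
    unfolding g_def by (rule f_the_inv_into_f_bij_betw[OF h(1)]) (use that in simp)
  have gM: "g i \<in> {..<card M}" if "i \<in> M" for i
    using g that by (auto simp: bij_betw_def)
  have "strict_mono_on M (k \<circ> g)"
  proof (rule strict_mono_onI)
    fix i j assume *: "i \<in> M" "j \<in> M" "i < j"
    have "g i < g j"
    proof (rule ccontr)
      assume "\<not> g i < g j"
      then have "h (g j) \<le> h (g i)"
        using strict_mono_on_leD[OF h(2) gM gM, of j i] * by simp
      then show False using hg * by simp
    qed
    then show "(k \<circ> g) i < (k \<circ> g) j"
      using strict_mono_onD[OF k(2) gM gM] * by simp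
  qed
  moreover have "bij_betw (k \<circ> g) M N"
    by (rule bij_betw_trans[OF g k(1)])
  ultimately show thesis by (rule that)
qed

text \<open>A choice depending only on the two mark sets makes the glued graph a function of the two
  forests.\<close>

definition matching :: "nat set \<Rightarrow> nat set \<Rightarrow> nat \<Rightarrow> nat" where
  "matching M N = (SOME f. strict_mono_on M f \<and> bij_betw f M N)"

lemma matching:
  assumes "finite M" "finite N" "card M = card N"
  shows "strict_mono_on M (matching M N)" "bij_betw (matching M N) M N"
proof -
  have "\<exists>f. strict_mono_on M f \<and> bij_betw f M N"
    using ex_strict_mono_bij[OF assms] by blast
  from someI_ex[OF this] show "strict_mono_on M (matching M N)" "bij_betw (matching M N) M N"
    by (simp_all add: matching_def)
qed

definition bridged :: "point list \<Rightarrow> point list \<Rightarrow> nat set set \<Rightarrow> nat set set \<Rightarrow> nat set \<Rightarrow> (nat \<Rightarrow> nat)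
    \<Rightarrow> point set set" where
  "bridged U L E F M f =
     image (nth U) ` E \<union> image (nth L) ` F \<union> {{U ! i, L ! f i} | i. i \<in> M}"

lemma edges_on_nth_image:
  assumes "a \<in> edges_on {..<length ps}"
  shows "nth ps ` a \<subseteq> set ps" "nth ps ` a \<noteq> {}"
  using assms by (auto simp: edges_on_def)

text \<open>The chains are disjoint, so edges within \<open>U\<close>, within \<open>L\<close> and
  between them can be told apart; this inverts the gluing and later yields injectivity.\<close>

lemma bridged_recover:
  assumes U: "inj_on (nth U) {..<length U}" and L: "inj_on (nth L) {..<length L}"
    and disj: "set U \<inter> set L = {}"
    and E: "E \<subseteq> edges_on {..<length U}" and F: "F \<subseteq> edges_on {..<length L}"
    and M: "M \<subseteq> {..<length U}" and f: "f ` M \<subseteq> {..<length L}"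
  defines "G \<equiv> bridged U L E F M f"
  shows "{a \<in> edges_on {..<length U}. nth U ` a \<in> G} = E"
    and "{a \<in> edges_on {..<length L}. nth L ` a \<in> G} = F"
    and "{i. i < length U \<and> (\<exists>v\<in>set L. {U ! i, v} \<in> G)} = M"
    and "{j. j < length L \<and> (\<exists>v\<in>set U. {v, L ! j} \<in> G)} = f ` M"
proof -
  have UM: "U ! i \<in> set U" "L ! f i \<in> set L" if "i \<in> M" for i
    using that M f by auto
  have UL: "x \<notin> set L" if "x \<in> set U" for x
    using that disj by blast
  have EU: "e \<subseteq> set U" "e \<noteq> {}" if "e \<in> image (nth U) ` E" for e
    using that E edges_on_nth_image[of _ U] by blast+
  have FL: "e \<subseteq> set L" "e \<noteq> {}" if "e \<in> image (nth L) ` F" for e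
    using that F edges_on_nth_image[of _ L] by blast+
  have G: "e \<in> G \<longleftrightarrow> e \<in> image (nth U) ` E \<or> e \<in> image (nth L) ` F \<or> (\<exists>i\<in>M. e = {U ! i, L ! f i})" for e
    unfolding G_def bridged_def by blast
  have UL': False if "e \<noteq> {}" "e \<subseteq> set U" "e \<subseteq> set L" for e
    using that disj by blast
  have GU: "e \<in> image (nth U) ` E" if e: "e \<in> G" "e \<subseteq> set U" for e
    using e(1) unfolding G
  proof (elim disjE bexE)
    assume "e \<in> image (nth L) ` F"
    then show ?thesis using FL[of e] UL'[of e] e(2) by blast
  next
    fix i assume "i \<in> M" "e = {U ! i, L ! f i}"
    then show ?thesis using UM(2)[of i] UL[of "L ! f i"] e(2) by simp
  qed
  have GL: "e \<in> image (nth L) ` F" if e: "e \<in> G" "e \<subseteq> set L" for e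
    using e(1) unfolding G
  proof (elim disjE bexE)
    assume "e \<in> image (nth U) ` E"
    then show ?thesis using EU[of e] UL'[of e] e(2) by blast
  next
    fix i assume "i \<in> M" "e = {U ! i, L ! f i}"
    then show ?thesis using UM(1)[of i] UL[of "U ! i"] e(2) by simp
  qed
  have GB: "\<exists>i\<in>M. U ! i = u \<and> L ! f i = v" if uv: "{u, v} \<in> G" "u \<in> set U" "v \<in> set L" for u v
    using uv(1) unfolding G
  proof (elim disjE bexE)
    assume "{u, v} \<in> image (nth U) ` E"
    then show ?thesis using EU(1)[of "{u, v}"] UL[of v] uv(3) by simp
  next
    assume "{u, v} \<in> image (nth L) ` F"
    then show ?thesis using FL(1)[of "{u, v}"] UL[of u] uv(2) by simp
  next
    fix i assume i: "i \<in> M" "{u, v} = {U ! i, L ! f i}"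
    have "u \<noteq> L ! f i" using UM(2)[OF i(1)] UL[OF uv(2)] by metis
    then have "u = U ! i \<and> v = L ! f i" using i(2) unfolding doubleton_eq_iff by simp
    then show ?thesis using i(1) by blast
  qed
  have inj: "a = b" if "inj_on (nth ps) {..<length ps}" "nth ps ` a = nth ps ` b"
    "a \<in> edges_on {..<length ps}" "b \<in> edges_on {..<length ps}" for ps :: "point list" and a b
    using inj_on_image_eq_iff[OF that(1), of a b] that by (simp add: edges_on_def)
  show "{a \<in> edges_on {..<length U}. nth U ` a \<in> G} = E"
  proof (intro subset_antisym subsetI)
    fix a assume "a \<in> {a \<in> edges_on {..<length U}. nth U ` a \<in> G}"
    then have a: "a \<in> edges_on {..<length U}" "nth U ` a \<in> G" by auto
    from GU[OF a(2) edges_on_nth_image(1)[OF a(1)]] obtain b where "b \<in> E" "nth U ` a = nth U ` b"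
      by blast
    then show "a \<in> E" using inj[OF U _ a(1), of b] E by blast
  next
    fix a assume "a \<in> E"
    then show "a \<in> {a \<in> edges_on {..<length U}. nth U ` a \<in> G}"
      using E unfolding G by blast
  qed
  show "{a \<in> edges_on {..<length L}. nth L ` a \<in> G} = F"
  proof (intro subset_antisym subsetI)
    fix a assume "a \<in> {a \<in> edges_on {..<length L}. nth L ` a \<in> G}"
    then have a: "a \<in> edges_on {..<length L}" "nth L ` a \<in> G" by auto
    from GL[OF a(2) edges_on_nth_image(1)[OF a(1)]] obtain b where "b \<in> F" "nth L ` a = nth L ` b"
      by blast
    then show "a \<in> F" using inj[OF L _ a(1), of b] F by blast
  next
    fix a assume "a \<in> F"
    then show "a \<in> {a \<in> edges_on {..<length L}. nth L ` a \<in> G}"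
      using F unfolding G by blast
  qed
  show "{i. i < length U \<and> (\<exists>v\<in>set L. {U ! i, v} \<in> G)} = M"
  proof (intro subset_antisym subsetI)
    fix i assume "i \<in> {i. i < length U \<and> (\<exists>v\<in>set L. {U ! i, v} \<in> G)}"
    then obtain v where i: "i < length U" "v \<in> set L" "{U ! i, v} \<in> G" by blast
    then obtain m where m: "m \<in> M" "U ! m = U ! i" using GB[of "U ! i" v] by auto
    then have "m = i" using inj_onD[OF U m(2)] M i(1) by auto
    then show "i \<in> M" using m(1) by simp
  next
    fix i assume i: "i \<in> M"
    then have "{U ! i, L ! f i} \<in> G" unfolding G by blast
    then show "i \<in> {i. i < length U \<and> (\<exists>v\<in>set L. {U ! i, v} \<in> G)}"
      using UM(2)[OF i] M i by blast
  qed
  show "{j. j < length L \<and> (\<exists>v\<in>set U. {v, L ! j} \<in> G)} = f ` M"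
  proof (intro subset_antisym subsetI)
    fix j assume "j \<in> {j. j < length L \<and> (\<exists>v\<in>set U. {v, L ! j} \<in> G)}"
    then obtain v where j: "j < length L" "v \<in> set U" "{v, L ! j} \<in> G" by blast
    then obtain m where m: "m \<in> M" "L ! f m = L ! j" using GB[of v "L ! j"] by auto
    then have "f m = j" using inj_onD[OF L m(2)] f j(1) by auto
    then show "j \<in> f ` M" using m(1) by blast
  next
    fix j assume "j \<in> f ` M"
    then show "j \<in> {j. j < length L \<and> (\<exists>v\<in>set U. {v, L ! j} \<in> G)}"
    proof (elim imageE)
      fix m assume m: "j = f m" "m \<in> M"
      have "{U ! m, L ! f m} \<in> G" using m(2) unfolding G by blast
      moreover have "f m < length L" using f m(2) by blast
      ultimately show ?thesis using UM(1)[OF m(2)] m(1) by blast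
    qed
  qed
qed

lemma last_map_image:
  assumes "\<And>xs. xs \<in> A \<Longrightarrow> xs \<noteq> []"
  shows "last ` map g ` A = g ` last ` A"
  unfolding image_image by (rule image_cong) (simp_all add: last_map assms)

text \<open>Transfers the path families from indices to points and glues them at the marks. Under
  \<open>ns\<close> every singleton is marked, hence glued.\<close>

lemma bridged_path_partition:
  fixes t t' :: "'f forest"
  assumes dc: "double_chain n U L" and t: "fsize t = n" "fsize t' = n"
    and f: "bij_betw f (fmarks h 0 t) (fmarks h 0 t')" and ns: "ns \<Longrightarrow> \<forall>b. h b"
  shows "path_partition ns (set U \<union> set L) (bridged U L (fedges 0 t) (fedges 0 t') (fmarks h 0 t) f)"
proof -
  note D = double_chain_chains[OF dc]
  have inj: "inj_on (nth U) {0..<n}" "inj_on (nth L) {0..<n}"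
    using chain_inj[OF D(1)] chain_inj[OF D(2)] D(3,4) by (simp_all add: lessThan_atLeast0)
  have setUL: "nth U ` {0..<n} = set U" "nth L ` {0..<n} = set L"
    using D(3,4) by (auto simp: set_conv_nth image_def)
  have fam: "path_family {0..<n} (fpaths 0 t)" "path_family {0..<n} (fpaths 0 t')"
    using path_family_paths(1)[of 0 t] path_family_paths(1)[of 0 t'] t by simp_all
  let ?A = "map (nth U) ` fpaths 0 t" and ?A' = "map (nth U) ` fmarked h 0 t"
  let ?B = "map (nth L) ` fpaths 0 t'" and ?B' = "map (nth L) ` fmarked h 0 t'"
  have lastA: "last ` ?A' = nth U ` fmarks h 0 t"
    by (subst last_map_image)
      (use path_familyD(1)[OF fam(1)] marked_subset_paths(1)[of h 0 t] last_marked(1)[of h 0 t] in auto)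
  have lastB: "last ` ?B' = nth L ` fmarks h 0 t'"
    by (subst last_map_image)
      (use path_familyD(1)[OF fam(2)] marked_subset_paths(1)[of h 0 t'] last_marked(1)[of h 0 t'] in auto)
  have marks: "fmarks h 0 t \<subseteq> {0..<n}" "fmarks h 0 t' \<subseteq> {0..<n}"
    using fmarks_range(1)[of h 0 t] fmarks_range(1)[of h 0 t'] t by simp_all
  \<comment> \<open>The bijection \<open>f\<close> of marked indices, read as a map between
    points.\<close>
  define g where "g = (\<lambda>v. L ! f (the_inv_into {0..<n} (nth U) v))"
  have g: "g (U ! i) = L ! f i" if "i \<in> fmarks h 0 t" for i
    using the_inv_into_f_f[OF inj(1), of i] that marks by (auto simp: g_def)
  have injU: "inj_on (nth U) (fmarks h 0 t)" and injL: "inj_on (nth L) (fmarks h 0 t')"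
    using inj marks by (auto intro: inj_on_subset)
  have bij: "bij_betw g (last ` ?A') (last ` ?B')"
  proof (rule bij_betw_imageI)
    show "inj_on g (last ` ?A')"
      unfolding lastA
    proof (rule inj_onI)
      fix u v assume uv: "u \<in> nth U ` fmarks h 0 t" "v \<in> nth U ` fmarks h 0 t" "g u = g v"
      then obtain i j where ij: "i \<in> fmarks h 0 t" "j \<in> fmarks h 0 t" "u = U ! i" "v = U ! j" by blast
      then have "L ! f i = L ! f j" using uv(3) g by simp
      moreover have "f i \<in> fmarks h 0 t'" "f j \<in> fmarks h 0 t'"
        using bij_betwE[OF f] ij by simp_all
      ultimately have "f i = f j" using inj_onD[OF injL] by blast
      then have "i = j" using inj_onD[OF bij_betw_imp_inj_on[OF f]] ij by blast
      then show "u = v" using ij by simp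
    qed
    have "g ` nth U ` fmarks h 0 t = nth L ` f ` fmarks h 0 t"
      unfolding image_image by (rule image_cong) (simp_all add: g)
    also have "f ` fmarks h 0 t = fmarks h 0 t'"
      using f by (simp add: bij_betw_def)
    finally show "g ` last ` ?A' = last ` ?B'"
      unfolding lastA lastB .
  qed
  have "path_partition ns (set U \<union> set L)
      (family_edges ?A \<union> family_edges ?B \<union> {{v, g v} | v. v \<in> last ` ?A'})"
  proof (rule path_partition_glue[OF _ _ D(5) _ _ bij])
    show "path_family (set U) ?A" "path_family (set L) ?B"
      using path_family_map[OF fam(1) inj(1)] path_family_map[OF fam(2) inj(2)] setUL by simp_all
    show "?A' \<subseteq> ?A" "?B' \<subseteq> ?B"
      by (intro image_mono marked_subset_paths(1))+
    show "\<forall>xs\<in>?A - ?A' \<union> (?B - ?B'). 2 \<le> length xs" if ns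
    proof
      have h: "h b" for b using ns[OF that] by blast
      fix xs assume "xs \<in> ?A - ?A' \<union> (?B - ?B')"
      then consider zs where "zs \<in> fpaths 0 t" "zs \<notin> fmarked h 0 t" "xs = map (nth U) zs"
        | zs where "zs \<in> fpaths 0 t'" "zs \<notin> fmarked h 0 t'" "xs = map (nth L) zs"
        by blast
      then show "2 \<le> length xs"
        by cases (use unmarked_length(1)[OF h] in simp_all)
    qed
  qed
  also have "{{v, g v} | v. v \<in> last ` ?A'} = {{U ! i, L ! f i} | i. i \<in> fmarks h 0 t}"
    unfolding Setcompr_eq_image lastA image_image[of _ "nth U"] by (rule image_cong) (simp_all add: g)
  finally show ?thesis
    by (simp only: bridged_def family_edges_map edges_of_paths(1))
qed

section \<open>Counting the glued graphs\<close>

lemma finite_path_partitions: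
  assumes "finite S"
  shows "finite {E. path_partition ns S E \<and> P E}"
proof (rule finite_subset)
  show "{E. path_partition ns S E \<and> P E} \<subseteq> Pow (Pow S)"
    unfolding path_partition_def using path_edges_subset by fast
qed (use assms in simp)

text \<open>Cauchy-Schwarz over the n + 1 possible weights: \<open>card T\<close> is the sum of the
  class sizes, the number of pairs is the sum of their squares.\<close>

lemma card_equal_weight_pairs:
  fixes w :: "'a \<Rightarrow> nat"
  assumes T: "finite T" and w: "\<And>t. t \<in> T \<Longrightarrow> w t \<le> n"
  shows "(real (card T))\<^sup>2 \<le> real (card {(s, t). s \<in> T \<and> t \<in> T \<and> w s = w t}) * real (n + 1)"
proof -
  let ?c = "\<lambda>m. {t \<in> T. w t = m}"
  have "T = (\<Union>m\<in>{..n}. ?c m)" using w by auto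
  then have "card T = card (\<Union>m\<in>{..n}. ?c m)" by simp
  also have "\<dots> = (\<Sum>m\<le>n. card (?c m))"
    by (rule card_UN_disjoint) (use T in auto)
  finally have cT: "real (card T) = (\<Sum>m\<le>n. real (card (?c m)))" by simp
  have "{(s, t). s \<in> T \<and> t \<in> T \<and> w s = w t} = (\<Union>m\<in>{..n}. ?c m \<times> ?c m)" using w by auto
  then have "card {(s, t). s \<in> T \<and> t \<in> T \<and> w s = w t} = card (\<Union>m\<in>{..n}. ?c m \<times> ?c m)" by simp
  also have "\<dots> = (\<Sum>m\<le>n. card (?c m \<times> ?c m))"
    by (rule card_UN_disjoint) (use T in auto)
  finally have "real (card {(s, t). s \<in> T \<and> t \<in> T \<and> w s = w t}) = (\<Sum>m\<le>n. (real (card (?c m)))\<^sup>2)"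
    by (simp add: card_cartesian_product power2_eq_square)
  then show ?thesis
    using sum_squared_le_sum_of_squares[of "\<lambda>m. real (card (?c m))" "{..n}"] cT by simp
qed

text \<open>Gluing maps the pairs of forests with equally many marks injectively to the graphs
  counted, by \<open>bridged_recover\<close> and \<open>decode_inj\<close>; Cauchy-Schwarz bounds
  the number of pairs from below.\<close>

lemma card_path_partitions_ge:
  fixes h :: "'f :: finite \<Rightarrow> bool"
  assumes dc: "double_chain n U L" and h: "inj h" and ns: "ns \<Longrightarrow> \<forall>b. h b"
  shows "(forest_count TYPE('f) n)\<^sup>2
    \<le> real (card {E. path_partition ns (set U \<union> set L) E \<and> non_crossing E}) * real (n + 1)"
proof -
  note D = double_chain_chains[OF dc]
  let ?T = "{t :: 'f forest. fsize t = n}"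
  let ?R = "{(s, t). s \<in> ?T \<and> t \<in> ?T \<and> card (fmarks h 0 s) = card (fmarks h 0 t)}"
  let ?S = "{E. path_partition ns (set U \<union> set L) E \<and> non_crossing E}"
  define \<Phi> where "\<Phi> = (\<lambda>(s :: 'f forest, t :: 'f forest).
    bridged U L (fedges 0 s) (fedges 0 t) (fmarks h 0 s) (matching (fmarks h 0 s) (fmarks h 0 t)))"
  have marks: "fmarks h 0 t \<subseteq> {..<n}" "fedges 0 t \<subseteq> edges_on {..<n}" if "t \<in> ?T" for t :: "'f forest"
    using fmarks_range(1)[of h 0 t] fedges_range(1)[of 0 t] that by (simp_all add: lessThan_atLeast0)
  have fin: "finite (fmarks h 0 t)" if "t \<in> ?T" for t :: "'f forest"
    using marks(1)[OF that] finite_subset by blast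
  have match: "strict_mono_on (fmarks h 0 s) (matching (fmarks h 0 s) (fmarks h 0 t))"
    "bij_betw (matching (fmarks h 0 s) (fmarks h 0 t)) (fmarks h 0 s) (fmarks h 0 t)"
    "matching (fmarks h 0 s) (fmarks h 0 t) ` fmarks h 0 s = fmarks h 0 t"
    if "(s, t) \<in> ?R" for s t
    using matching[of "fmarks h 0 s" "fmarks h 0 t"] fin that by (auto simp: bij_betw_def)
  have range: "\<Phi> st \<in> ?S" if "st \<in> ?R" for st
  proof -
    obtain s t where st: "st = (s, t)" by fastforce
    then have *: "(s, t) \<in> ?R" "s \<in> ?T" "t \<in> ?T" using that by auto
    have "path_partition ns (set U \<union> set L) (\<Phi> st)"
      unfolding \<Phi>_def st prod.case
      by (rule bridged_path_partition[OF dc _ _ match(2)[OF *(1)] ns]) (use * in simp_all)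
    moreover have "non_crossing (\<Phi> st)"
      unfolding \<Phi>_def st prod.case bridged_def
      by (rule double_chain_non_crossing[OF dc marks(2)[OF *(2)] interleaving_free_edges(1)
            marks(2)[OF *(3)] interleaving_free_edges(1) marks(1)[OF *(2)] match(1)[OF *(1)]])
        (simp only: match(3)[OF *(1)] marks(1)[OF *(3)])
    ultimately show ?thesis by simp
  qed
  have inj: "inj_on \<Phi> ?R"
  proof (rule inj_onI)
    fix x y assume xy: "x \<in> ?R" "y \<in> ?R" "\<Phi> x = \<Phi> y"
    obtain s t s' t' where st: "x = (s, t)" "y = (s', t')" by fastforce
    have mem: "(s, t) \<in> ?R" "(s', t') \<in> ?R" "s \<in> ?T" "t \<in> ?T" "s' \<in> ?T" "t' \<in> ?T"
      using xy st by auto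
    have rec: "{a \<in> edges_on {..<length U}. nth U ` a \<in> \<Phi> (s, t)} = fedges 0 s"
      "{a \<in> edges_on {..<length L}. nth L ` a \<in> \<Phi> (s, t)} = fedges 0 t"
      "{i. i < length U \<and> (\<exists>v\<in>set L. {U ! i, v} \<in> \<Phi> (s, t))} = fmarks h 0 s"
      "{j. j < length L \<and> (\<exists>v\<in>set U. {v, L ! j} \<in> \<Phi> (s, t))} = fmarks h 0 t"
      if "(s, t) \<in> ?R" "s \<in> ?T" "t \<in> ?T" for s t
    proof -
      note * = bridged_recover[of U L "fedges 0 s" "fedges 0 t" "fmarks h 0 s"
        "matching (fmarks h 0 s) (fmarks h 0 t)", OF chain_inj[OF D(1)] chain_inj[OF D(2)] D(5),
        unfolded D(3,4), OF marks(2)[OF that(2)] marks(2)[OF that(3)] marks(1)[OF that(2)],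
        unfolded match(3)[OF that(1)], OF marks(1)[OF that(3)]]
      show "{a \<in> edges_on {..<length U}. nth U ` a \<in> \<Phi> (s, t)} = fedges 0 s"
        "{a \<in> edges_on {..<length L}. nth L ` a \<in> \<Phi> (s, t)} = fedges 0 t"
        "{i. i < length U \<and> (\<exists>v\<in>set L. {U ! i, v} \<in> \<Phi> (s, t))} = fmarks h 0 s"
        "{j. j < length L \<and> (\<exists>v\<in>set U. {v, L ! j} \<in> \<Phi> (s, t))} = fmarks h 0 t"
        unfolding \<Phi>_def prod.case D(3,4) by (rule *)+
    qed
    have eq: "\<Phi> (s, t) = \<Phi> (s', t')" using xy st by simp
    have "fedges 0 s = fedges 0 s'" "fmarks h 0 s = fmarks h 0 s'"
      "fedges 0 t = fedges 0 t'" "fmarks h 0 t = fmarks h 0 t'"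
      using rec[OF mem(1,3,4)] rec[OF mem(2,5,6)] unfolding eq by (simp_all only:)
    then have "s = s'" "t = t'"
      using decode_inj(1)[OF h, of s s' 0] decode_inj(1)[OF h, of t t' 0] mem by simp_all
    then show "x = y" using st by simp
  qed
  have "finite ?S" by (rule finite_path_partitions) simp
  then have "card ?R \<le> card ?S"
    by (intro card_inj_on_le[OF inj]) (use range in auto)
  then have "real (card ?R) * real (n + 1) \<le> real (card ?S) * real (n + 1)"
    by (intro mult_right_mono) simp_all
  moreover have "(real (card ?T))\<^sup>2 \<le> real (card ?R) * real (n + 1)"
  proof (rule card_equal_weight_pairs)
    show "card (fmarks h 0 t) \<le> n" if "t \<in> ?T" for t :: "'f forest"
      using card_mono[OF _ marks(1)[OF that]] by simp
  qed (rule finite_levels)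
  ultimately show ?thesis unfolding forest_count_def by linarith
qed

text \<open>A slightly larger base pays for the factor n + 1 lost in Cauchy-Schwarz. With \<theta> =
  (1 + x) a, Bernoulli gives (1 + x)^(2n) \<ge> 1 + 2nx, which is at least min 1 (2x) times n +
  1.\<close>

lemma linear_factor_absorbed:
  fixes a \<theta> :: real
  assumes "0 < a" "a < \<theta>"
  shows "\<exists>K>0. \<forall>n. K * real (n + 1) * a ^ (2 * n) \<le> \<theta> ^ (2 * n)"
proof -
  define x where "x = \<theta> / a - 1"
  have x: "x > 0" "\<theta> = (1 + x) * a" using assms by (simp_all add: x_def field_simps)
  have "min 1 (2 * x) * real (n + 1) * a ^ (2 * n) \<le> \<theta> ^ (2 * n)" for n
  proof -
    have "min 1 (2 * x) * real n \<le> 2 * x * real n" "min 1 (2 * x) \<le> 1"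
      by (intro mult_right_mono) simp_all
    then have "min 1 (2 * x) * real (n + 1) \<le> 1 + real (2 * n) * x"
      by (simp add: algebra_simps)
    also have "\<dots> \<le> (1 + x) ^ (2 * n)"
      by (rule Bernoulli_inequality) (use x in simp)
    finally have "min 1 (2 * x) * real (n + 1) * a ^ (2 * n) \<le> (1 + x) ^ (2 * n) * a ^ (2 * n)"
      by (rule mult_right_mono) (use assms in simp)
    then show ?thesis unfolding x(2) power_mult_distrib .
  qed
  moreover have "min 1 (2 * x) > 0" using x(1) by simp
  ultimately show ?thesis by blast
qed

text \<open>A base \<theta> strictly between \<open>a\<close> and w + 21/4 is used for the forests;
  the gap between \<open>a\<close> and \<theta> absorbs the factor n + 1.\<close>

lemma path_partitions_growth:
  fixes h :: "'f :: finite \<Rightarrow> bool" and a :: real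
  assumes h: "inj h" and ns: "ns \<Longrightarrow> \<forall>b. h b"
    and a: "1 \<le> a" "a < real CARD('f) + 21/4"
  shows "\<exists>c>0. \<forall>n U L. double_chain n U L \<longrightarrow>
    c * a ^ (2 * n) \<le> real (card {E. path_partition ns (set U \<union> set L) E \<and> non_crossing E})"
proof -
  obtain \<theta> where \<theta>: "a < \<theta>" "\<theta> < real CARD('f) + 21/4" using dense[OF a(2)] by blast
  obtain c where c: "c > 0" "\<And>n. c * \<theta> ^ n \<le> forest_count TYPE('f) n"
    using forest_count_growth[OF \<theta>(2)] \<theta>(1) a(1) by auto
  obtain K where K: "K > 0" "\<And>n. K * real (n + 1) * a ^ (2 * n) \<le> \<theta> ^ (2 * n)"
    using linear_factor_absorbed[of a \<theta>] a(1) \<theta>(1) by auto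
  have "c\<^sup>2 * K * a ^ (2 * n) \<le> real (card {E. path_partition ns (set U \<union> set L) E \<and> non_crossing E})"
    (is "_ \<le> ?N") if dc: "double_chain n U L" for n U L
  proof -
    have "c\<^sup>2 * K * a ^ (2 * n) * real (n + 1) = c\<^sup>2 * (K * real (n + 1) * a ^ (2 * n))"
      by (simp add: algebra_simps)
    also have "\<dots> \<le> c\<^sup>2 * \<theta> ^ (2 * n)"
      by (intro mult_left_mono K) simp
    also have "\<dots> = (c * \<theta> ^ n)\<^sup>2"
      by (simp only: power_mult_distrib power_even_eq)
    also have "\<dots> \<le> (forest_count TYPE('f) n)\<^sup>2"
      by (intro power_mono c) (use c(1) \<theta>(1) a(1) in simp)
    also have "\<dots> \<le> ?N * real (n + 1)"
      by (rule card_path_partitions_ge[OF dc h ns])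
    finally show ?thesis by (rule mult_right_le_imp_le) simp
  qed
  moreover have "c\<^sup>2 * K > 0" using c(1) K(1) by simp
  ultimately show ?thesis by blast
qed

theorem theorem6:
  shows "\<exists>c>0. \<exists>n0::nat. \<forall>n\<ge>n0. \<forall>U L. double_chain n U L \<longrightarrow>
     real (card {E. ncp_partition (set U \<union> set L) E}) \<ge> c * (7.164102920::real) ^ (2 * n) \<and>
     real (card {E. ncpws_partition (set U \<union> set L) E}) \<ge> c * (6.164492582::real) ^ (2 * n)"
proof -
  \<comment> \<open>With singletons allowed, each is marked or unmarked: two kinds, indexed by
    \<open>bool\<close>, and the rate 2 + 21/4 = 7.25 suffices.\<close>
  obtain c where c: "c > 0" "\<And>n U L. double_chain n U L \<Longrightarrow>
      c * 7.164102920 ^ (2 * n) \<le> real (card {E. ncp_partition (set U \<union> set L) E})"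
    using path_partitions_growth[of "id :: bool \<Rightarrow> bool" False "7.164102920"]
    unfolding ncp_partition_def by auto
  \<comment> \<open>Without singletons every one-vertex path is marked: a single kind, indexed by
    \<open>unit\<close>, and the rate 1 + 21/4 = 6.25 suffices.\<close>
  obtain d where d: "d > 0" "\<And>n U L. double_chain n U L \<Longrightarrow>
      d * 6.164492582 ^ (2 * n) \<le> real (card {E. ncpws_partition (set U \<union> set L) E})"
    using path_partitions_growth[of "\<lambda>_ :: unit. True" True "6.164492582"]
    unfolding ncpws_partition_def by (auto simp: inj_def)
  \<comment> \<open>The smaller constant serves both bounds, and they hold for every n, so any
    \<open>n0\<close> will do.\<close>
  have "min c d * 7.164102920 ^ (2 * n) \<le> real (card {E. ncp_partition (set U \<union> set L) E}) \<and>
      min c d * 6.164492582 ^ (2 * n) \<le> real (card {E. ncpws_partition (set U \<union> set L) E})"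
    if dc: "double_chain n U L" for n U L
  proof
    have "min c d * 7.164102920 ^ (2 * n) \<le> c * 7.164102920 ^ (2 * n)"
      "min c d * 6.164492582 ^ (2 * n) \<le> d * 6.164492582 ^ (2 * n)"
      by (intro mult_right_mono; simp)+
    then show "min c d * 7.164102920 ^ (2 * n) \<le> real (card {E. ncp_partition (set U \<union> set L) E})"
      "min c d * 6.164492582 ^ (2 * n) \<le> real (card {E. ncpws_partition (set U \<union> set L) E})"
      using c(2)[OF dc] d(2)[OF dc] by linarith+
  qed
  moreover have "min c d > 0" using c(1) d(1) by simp
  ultimately show ?thesis by blast
qed

end
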